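(* Let $G$ be a group and $H$ a proper malnormal subgroup. For any $g\in G\setminus H$ the following identities of ring homomorphisms hold: $$f_g\circ q=\mathrm{id}_{A'\mathcal{G}_{G,H}},\qquad q\circ f_g=r_{v_{g^{-1}}}.$$
   Context: $H\subset G$ is malnormal if $gHg^{-1}\cap H\ne\{1\}$ implies $g\in H$. Rings are unital, not necessarily commutative. The ring $A'\mathcal{G}_{G,H}$ is generated over $\mathbb{Z}$ by invertible elements $u_{x,y}$, $x,y\in G\setminus H$, subject to the relations: $u_{x,y}u_{y,z}=u_{x,z}$; $u_{xh,y}=u_{x,yh}=u_{hx,hy}=u_{x,y}$ for all $h\in H$; and $u_{y^{-1}x,y^{-1}}+u_{x,y}=1$ whenever $y^{-1}x\notin H$. The ring $R_{G,H}$ is generated over $\mathbb{Z}$ by $\{s_g,v_g\mid g\in G\}$ subject to: $s_1=1$, $s_xs_y=s_{xy}$ for all $x,y\in G$; $v_x=0$ if $x\in H$ and $v_x$ is invertible if $x\notin H$; $v_{xy}=v_y+v_xs_y$ for all $x,y\in G$. $q\colon A'\mathcal{G}_{G,H}\to R_{G,H}$ is the ring homomorphism with $q(u_{x,y})=v_{x^{-1}}v_{y^{-1}}^{-1}$. For $g\in G\setminus H$, $f_g\colon R_{G,H}\to A'\mathcal{G}_{G,H}$ is the ring homomorphism with $f_g(s_x)=u_{g,xg}=u_{x^{-1}g,g}$ if $x\in H$, $f_g(s_x)=-u_{g,x}u_{x^{-1},g}$ if $x\notin H$, and $f_g(v_x)=0$ if $x\in H$, $f_g(v_x)=u_{x^{-1},g}$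 if $x\notin H$. For an invertible $t\in R_{G,H}$, $r_t\colon R_{G,H}\to R_{G,H}$ is the ring endomorphism with $r_t(s_x)=ts_xt^{-1}$ and $r_t(v_x)=v_xt^{-1}$ for all $x\in G$. *)

theory Defs
  imports "HOL-Algebra.QuotRing" "HOL-Library.Poly_Mapping"
begin

section \<open>Unital associative rings given by generators and relations\<close>

text \<open>Lists under concatenation, wrapped so that finitely supported integer functions on words form
  (with the convolution product of \<^theory>\<open>HOL-Library.Poly_Mapping\<close>) the free associative unital ring.\<close>

datatype 'a word = Word (letters: "'a list")

instantiation word :: (type) monoid_add
begin
definition zero_word :: "'a word" where "zero_word = Word []"
definition plus_word :: "'a word \<Rightarrow> 'a word \<Rightarrow> 'a word" where
  "plus_word v w = Word (letters v @ letters w)"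
instance by standard (auto simp: zero_word_def plus_word_def)
end

definition free_ring :: "'a set \<Rightarrow> ('a word \<Rightarrow>\<^sub>0 int) ring" where
  "free_ring A = \<lparr>carrier = {p. \<forall>w \<in> Poly_Mapping.keys p. set (letters w) \<subseteq> A},
     mult = (*), one = 1, zero = 0, add = (+)\<rparr>"

definition gen :: "'a \<Rightarrow> ('a word \<Rightarrow>\<^sub>0 int)" where
  "gen x = Poly_Mapping.single (Word [x]) 1"

text \<open>The elements of \<open>E\<close> are the polynomials that are set to zero; \<open>cls A E p\<close> is the class of \<open>p\<close> in the quotient.\<close>

definition presented_ring :: "'a set \<Rightarrow> ('a word \<Rightarrow>\<^sub>0 int) set \<Rightarrow> ('a word \<Rightarrow>\<^sub>0 int) set ring" where
  "presented_ring A E = free_ring A Quot (genideal (free_ring A) E)"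

definition cls :: "'a set \<Rightarrow> ('a word \<Rightarrow>\<^sub>0 int) set \<Rightarrow> ('a word \<Rightarrow>\<^sub>0 int) \<Rightarrow> ('a word \<Rightarrow>\<^sub>0 int) set" where
  "cls A E p = genideal (free_ring A) E +>\<^bsub>free_ring A\<^esub> p"

section \<open>Malnormal subgroups\<close>

definition malnormal :: "'g set \<Rightarrow> ('g, 'm) monoid_scheme \<Rightarrow> bool" where
  "malnormal H G \<longleftrightarrow> subgroup H G \<and>
     (\<forall>g \<in> carrier G. ((g <#\<^bsub>G\<^esub> H) #>\<^bsub>G\<^esub> inv\<^bsub>G\<^esub> g) \<inter> H \<noteq> {\<one>\<^bsub>G\<^esub>} \<longrightarrow> g \<in> H)"

section \<open>The two rings\<close>

text \<open>Invertibility of a generator is imposed by adjoining a formal two-sided inverse.\<close>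

datatype 'g u_gen = Ugen 'g 'g | Uinv 'g 'g

definition AG_gens :: "('g, 'm) monoid_scheme \<Rightarrow> 'g set \<Rightarrow> 'g u_gen set" where
  "AG_gens G H = {Ugen x y | x y. x \<in> carrier G - H \<and> y \<in> carrier G - H}
     \<union> {Uinv x y | x y. x \<in> carrier G - H \<and> y \<in> carrier G - H}"

definition AG_rels :: "('g, 'm) monoid_scheme \<Rightarrow> 'g set \<Rightarrow> ('g u_gen word \<Rightarrow>\<^sub>0 int) set" where
  "AG_rels G H =
     {gen (Ugen x y) * gen (Uinv x y) - 1 | x y. x \<in> carrier G - H \<and> y \<in> carrier G - H}
   \<union> {gen (Uinv x y) * gen (Ugen x y) - 1 | x y. x \<in> carrier G - H \<and> y \<in> carrier G - H}
   \<union> {gen (Ugen x y) * gen (Ugen y z) - gen (Ugen x z) | x y z.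
        x \<in> carrier G - H \<and> y \<in> carrier G - H \<and> z \<in> carrier G - H}
   \<union> {gen (Ugen (x \<otimes>\<^bsub>G\<^esub> h) y) - gen (Ugen x y) | x y h.
        x \<in> carrier G - H \<and> y \<in> carrier G - H \<and> h \<in> H}
   \<union> {gen (Ugen x (y \<otimes>\<^bsub>G\<^esub> h)) - gen (Ugen x y) | x y h.
        x \<in> carrier G - H \<and> y \<in> carrier G - H \<and> h \<in> H}
   \<union> {gen (Ugen (h \<otimes>\<^bsub>G\<^esub> x) (h \<otimes>\<^bsub>G\<^esub> y)) - gen (Ugen x y) | x y h.
        x \<in> carrier G - H \<and> y \<in> carrier G - H \<and> h \<in> H}
   \<union> {gen (Ugen (inv\<^bsub>G\<^esub> y \<otimes>\<^bsub>G\<^esub> x) (inv\<^bsub>G\<^esub> y)) + gen (Ugen x y) - 1 | x y.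
        x \<in> carrier G - H \<and> y \<in> carrier G - H \<and> inv\<^bsub>G\<^esub> y \<otimes>\<^bsub>G\<^esub> x \<notin> H}"

definition AG_ring :: "('g, 'm) monoid_scheme \<Rightarrow> 'g set \<Rightarrow> ('g u_gen word \<Rightarrow>\<^sub>0 int) set ring" where
  "AG_ring G H = presented_ring (AG_gens G H) (AG_rels G H)"

definition u_elt :: "('g, 'm) monoid_scheme \<Rightarrow> 'g set \<Rightarrow> 'g \<Rightarrow> 'g \<Rightarrow> ('g u_gen word \<Rightarrow>\<^sub>0 int) set" where
  "u_elt G H x y = cls (AG_gens G H) (AG_rels G H) (gen (Ugen x y))"

datatype 'g sv_gen = Sgen 'g | Vgen 'g | Vinv 'g

definition R_gens :: "('g, 'm) monoid_scheme \<Rightarrow> 'g set \<Rightarrow> 'g sv_gen set" where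
  "R_gens G H = Sgen ` carrier G \<union> Vgen ` carrier G \<union> Vinv ` (carrier G - H)"

definition R_rels :: "('g, 'm) monoid_scheme \<Rightarrow> 'g set \<Rightarrow> ('g sv_gen word \<Rightarrow>\<^sub>0 int) set" where
  "R_rels G H =
     {gen (Sgen \<one>\<^bsub>G\<^esub>) - 1}
   \<union> {gen (Sgen x) * gen (Sgen y) - gen (Sgen (x \<otimes>\<^bsub>G\<^esub> y)) | x y. x \<in> carrier G \<and> y \<in> carrier G}
   \<union> {gen (Vgen x) | x. x \<in> H}
   \<union> {gen (Vgen x) * gen (Vinv x) - 1 | x. x \<in> carrier G - H}
   \<union> {gen (Vinv x) * gen (Vgen x) - 1 | x. x \<in> carrier G - H}
   \<union> {gen (Vgen (x \<otimes>\<^bsub>G\<^esub> y)) - (gen (Vgen y) + gen (Vgen x) * gen (Sgen y)) | x y.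
        x \<in> carrier G \<and> y \<in> carrier G}"

definition R_ring :: "('g, 'm) monoid_scheme \<Rightarrow> 'g set \<Rightarrow> ('g sv_gen word \<Rightarrow>\<^sub>0 int) set ring" where
  "R_ring G H = presented_ring (R_gens G H) (R_rels G H)"

definition s_elt :: "('g, 'm) monoid_scheme \<Rightarrow> 'g set \<Rightarrow> 'g \<Rightarrow> ('g sv_gen word \<Rightarrow>\<^sub>0 int) set" where
  "s_elt G H x = cls (R_gens G H) (R_rels G H) (gen (Sgen x))"

definition v_elt :: "('g, 'm) monoid_scheme \<Rightarrow> 'g set \<Rightarrow> 'g \<Rightarrow> ('g sv_gen word \<Rightarrow>\<^sub>0 int) set" where
  "v_elt G H x = cls (R_gens G H) (R_rels G H) (gen (Vgen x))"

section \<open>The homomorphisms\<close>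

text \<open>Homomorphisms are normalised to be \<open>undefined\<close> outside the carrier, so that equality of functions
  is equality of homomorphisms. That each description below has exactly one solution is proved
  at the end of this theory.\<close>

definition is_q :: "('g, 'm) monoid_scheme \<Rightarrow> 'g set
    \<Rightarrow> (('g u_gen word \<Rightarrow>\<^sub>0 int) set \<Rightarrow> ('g sv_gen word \<Rightarrow>\<^sub>0 int) set) \<Rightarrow> bool" where
  "is_q G H q \<longleftrightarrow> q \<in> ring_hom (AG_ring G H) (R_ring G H) \<inter> extensional (carrier (AG_ring G H)) \<and>
     (\<forall>x \<in> carrier G - H. \<forall>y \<in> carrier G - H.
        q (u_elt G H x y) =
          v_elt G H (inv\<^bsub>G\<^esub> x) \<otimes>\<^bsub>R_ring G H\<^esub> inv\<^bsub>R_ring G H\<^esub> (v_elt G H (inv\<^bsub>G\<^esub> y)))"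

text \<open>For \<open>x \<in> H\<close> both given expressions for the value at \<open>s x\<close> are required.\<close>

definition is_f :: "('g, 'm) monoid_scheme \<Rightarrow> 'g set \<Rightarrow> 'g
    \<Rightarrow> (('g sv_gen word \<Rightarrow>\<^sub>0 int) set \<Rightarrow> ('g u_gen word \<Rightarrow>\<^sub>0 int) set) \<Rightarrow> bool" where
  "is_f G H g f \<longleftrightarrow> f \<in> ring_hom (R_ring G H) (AG_ring G H) \<inter> extensional (carrier (R_ring G H)) \<and>
     (\<forall>x \<in> H. f (s_elt G H x) = u_elt G H g (x \<otimes>\<^bsub>G\<^esub> g)
            \<and> f (s_elt G H x) = u_elt G H (inv\<^bsub>G\<^esub> x \<otimes>\<^bsub>G\<^esub> g) g) \<and>
     (\<forall>x \<in> carrier G - H. f (s_elt G H x) =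
        \<ominus>\<^bsub>AG_ring G H\<^esub> (u_elt G H g x \<otimes>\<^bsub>AG_ring G H\<^esub> u_elt G H (inv\<^bsub>G\<^esub> x) g)) \<and>
     (\<forall>x \<in> H. f (v_elt G H x) = \<zero>\<^bsub>AG_ring G H\<^esub>) \<and>
     (\<forall>x \<in> carrier G - H. f (v_elt G H x) = u_elt G H (inv\<^bsub>G\<^esub> x) g)"

definition is_r :: "('g, 'm) monoid_scheme \<Rightarrow> 'g set \<Rightarrow> ('g sv_gen word \<Rightarrow>\<^sub>0 int) set
    \<Rightarrow> (('g sv_gen word \<Rightarrow>\<^sub>0 int) set \<Rightarrow> ('g sv_gen word \<Rightarrow>\<^sub>0 int) set) \<Rightarrow> bool" where
  "is_r G H t r \<longleftrightarrow> r \<in> ring_hom (R_ring G H) (R_ring G H) \<inter> extensional (carrier (R_ring G H)) \<and>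
     (\<forall>x \<in> carrier G.
        r (s_elt G H x) = t \<otimes>\<^bsub>R_ring G H\<^esub> s_elt G H x \<otimes>\<^bsub>R_ring G H\<^esub> inv\<^bsub>R_ring G H\<^esub> t \<and>
        r (v_elt G H x) = v_elt G H x \<otimes>\<^bsub>R_ring G H\<^esub> inv\<^bsub>R_ring G H\<^esub> t)"

definition q_hom :: "('g, 'm) monoid_scheme \<Rightarrow> 'g set
    \<Rightarrow> ('g u_gen word \<Rightarrow>\<^sub>0 int) set \<Rightarrow> ('g sv_gen word \<Rightarrow>\<^sub>0 int) set" where
  "q_hom G H = (THE q. is_q G H q)"
definition f_hom :: "('g, 'm) monoid_scheme \<Rightarrow> 'g set \<Rightarrow> 'g
    \<Rightarrow> ('g sv_gen word \<Rightarrow>\<^sub>0 int) set \<Rightarrow> ('g u_gen word \<Rightarrow>\<^sub>0 int) set" where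
  "f_hom G H g = (THE f. is_f G H g f)"
definition r_hom :: "('g, 'm) monoid_scheme \<Rightarrow> 'g set \<Rightarrow> ('g sv_gen word \<Rightarrow>\<^sub>0 int) set
    \<Rightarrow> ('g sv_gen word \<Rightarrow>\<^sub>0 int) set \<Rightarrow> ('g sv_gen word \<Rightarrow>\<^sub>0 int) set" where
  "r_hom G H t = (THE r. is_r G H t r)"


section \<open>Existence and uniqueness of the homomorphisms\<close>

subsection \<open>The universal property of a presented ring\<close>

lemma keys_mult_word:
  assumes "w \<in> Poly_Mapping.keys (p * q :: 'a word \<Rightarrow>\<^sub>0 int)"
  obtains a b where "a \<in> Poly_Mapping.keys p" "b \<in> Poly_Mapping.keys q" "w = a + b"
  using assms keys_mult[of p q] by blast

lemma free_ring_simps [simp]: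
  "p \<otimes>\<^bsub>free_ring A\<^esub> q = p * q" "\<one>\<^bsub>free_ring A\<^esub> = 1" "\<zero>\<^bsub>free_ring A\<^esub> = 0" "p \<oplus>\<^bsub>free_ring A\<^esub> q = p + q"
  by (simp_all add: free_ring_def)

lemma ring_free_ring: "ring (free_ring A)"
proof -
  let ?C = "carrier (free_ring A)"
  have C: "p \<in> ?C \<longleftrightarrow> (\<forall>w \<in> Poly_Mapping.keys p. set (letters w) \<subseteq> A)" for p
    by (simp add: free_ring_def)
  have add: "p + q \<in> ?C" if "p \<in> ?C" "q \<in> ?C" for p q
    using that keys_add[of p q] unfolding C by blast
  have mult: "p * q \<in> ?C" if "p \<in> ?C" "q \<in> ?C" for p q
    unfolding C
  proof
    fix w assume "w \<in> Poly_Mapping.keys (p * q)"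
    then show "set (letters w) \<subseteq> A"
      by (rule keys_mult_word) (use that in \<open>simp add: C plus_word_def\<close>)
  qed
  have uminus: "- p \<in> ?C" if "p \<in> ?C" for p
    using that unfolding C by simp
  have one: "1 \<in> ?C" unfolding C by (simp add: zero_word_def)
  have zero: "0 \<in> ?C" unfolding C by simp
  show ?thesis
  proof (rule ringI)
    show "abelian_group (free_ring A)"
    proof (rule abelian_groupI)
      show "\<exists>q \<in> ?C. q \<oplus>\<^bsub>free_ring A\<^esub> p = \<zero>\<^bsub>free_ring A\<^esub>" if "p \<in> ?C" for p
        using uminus[OF that] by (intro bexI[of _ "- p"]) simp_all
    qed (simp_all only: free_ring_simps add zero ac_simps add_0_left add_0_right)
    show "monoid (free_ring A)"
      by (rule monoidI) (simp_all only: free_ring_simps mult one mult.assoc mult_1_left mult_1_right)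
  qed (simp_all only: free_ring_simps distrib_left distrib_right)
qed

lemma gen_in_free [simp]: "gen x \<in> carrier (free_ring A) \<longleftrightarrow> x \<in> A"
  by (simp add: free_ring_def gen_def)

lemma free_closed [simp]:
  assumes "p \<in> carrier (free_ring A)" "q \<in> carrier (free_ring A)"
  shows "p + q \<in> carrier (free_ring A)" "p * q \<in> carrier (free_ring A)" "p - q \<in> carrier (free_ring A)"
proof -
  interpret F: ring "free_ring A" by (rule ring_free_ring)
  show "p + q \<in> carrier (free_ring A)" "p * q \<in> carrier (free_ring A)"
    using F.a_closed[of p q] F.m_closed[of p q] assms by auto
  show "p - q \<in> carrier (free_ring A)"
    using assms keys_diff[of p q] by (auto simp: free_ring_def)
qed

lemma free_closed_consts [simp]: "1 \<in> carrier (free_ring A)" "0 \<in> carrier (free_ring A)"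
  by (simp_all add: free_ring_def zero_word_def)

lemma free_a_inv: "p \<in> carrier (free_ring A) \<Longrightarrow> \<ominus>\<^bsub>free_ring A\<^esub> p = - p"
proof -
  interpret F: ring "free_ring A" by (rule ring_free_ring)
  assume p: "p \<in> carrier (free_ring A)"
  then have "- p \<in> carrier (free_ring A)" by (simp add: free_ring_def)
  with p show ?thesis using F.minus_equality[of "- p" p] by simp
qed

lemma pm_split_induct [case_names zero single]:
  fixes p :: "'a \<Rightarrow>\<^sub>0 int"
  assumes "P 0"
    and "\<And>a b p. a \<notin> Poly_Mapping.keys p \<Longrightarrow> b \<noteq> 0 \<Longrightarrow> P p \<Longrightarrow> P (Poly_Mapping.single a b + p)"
  shows "P p"
proof (induction p rule: update_induct)
  case const show ?case by (rule assms(1))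
next
  case (update f a b)
  have "Poly_Mapping.update a b f = Poly_Mapping.single a b + f"
    using update(1)
    by (intro poly_mapping_eqI) (auto simp: lookup_update lookup_add lookup_single in_keys_iff when_def)
  then show ?case using assms(2) update by simp
qed

text \<open>Homomorphisms out of a free ring are determined on the generators.\<close>

lemma free_hom_unique:
  assumes T: "ring T" and h: "h \<in> ring_hom (free_ring A) T" and k: "k \<in> ring_hom (free_ring A) T"
    and eq: "\<And>x. x \<in> A \<Longrightarrow> h (gen x) = k (gen x)" and p: "p \<in> carrier (free_ring A)"
  shows "h p = k p"
proof -
  interpret T: ring T by (rule T)
  interpret F: ring "free_ring A" by (rule ring_free_ring)
  interpret h: ring_hom_ring "free_ring A" T h
    using h by (intro ring_hom_ringI2 ring_free_ring T)
  interpret k: ring_hom_ring "free_ring A" T k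
    using k by (intro ring_hom_ringI2 ring_free_ring T)
  define D where "D = {p \<in> carrier (free_ring A). h p = k p}"
  have D1: "1 \<in> D" "0 \<in> D"
    using h.hom_one k.hom_one h.hom_zero k.hom_zero by (auto simp: D_def)
  have Dadd: "p + q \<in> D" if "p \<in> D" "q \<in> D" for p q
    using that h.hom_add[of p q] k.hom_add[of p q] by (auto simp: D_def)
  have Dmult: "p * q \<in> D" if "p \<in> D" "q \<in> D" for p q
    using that h.hom_mult[of p q] k.hom_mult[of p q] by (auto simp: D_def)
  have Dneg: "- p \<in> D" if "p \<in> D" for p
    using that h.hom_a_inv[of p] k.hom_a_inv[of p] F.a_inv_closed[of p] by (auto simp: D_def free_a_inv)
  have Dnat: "of_nat n \<in> D" for n
    by (induction n) (use D1 Dadd in auto)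
  have Dint: "Poly_Mapping.single 0 b \<in> D" for b :: int
  proof -
    have "of_int b \<in> D"
    proof (cases b)
      case (nonneg n)
      then show ?thesis using Dnat[of n] by simp
    next
      case (neg n)
      then show ?thesis using Dneg[OF Dnat[of "Suc n"]] by (simp only: of_int_minus of_int_of_nat_eq)
    qed
    then show ?thesis by (metis single_of_int of_int_eq_id id_apply)
  qed
  have Dword: "set l \<subseteq> A \<Longrightarrow> Poly_Mapping.single (Word l) (1::int) \<in> D" for l
  proof (induction l)
    case Nil
    then show ?case using D1 by (simp add: zero_word_def[symmetric])
  next
    case (Cons x l)
    have "Poly_Mapping.single (Word (x # l)) (1::int) = gen x * Poly_Mapping.single (Word l) 1"
      by (simp add: gen_def mult_single plus_word_def)
    moreover have "gen x \<in> D" using Cons.prems eq by (simp add: D_def)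
    ultimately show ?case using Cons Dmult by simp
  qed
  have "p \<in> carrier (free_ring A) \<Longrightarrow> p \<in> D"
  proof (induction p rule: pm_split_induct)
    case zero show ?case by (rule D1)
  next
    case (single a b p)
    have keys: "Poly_Mapping.keys (Poly_Mapping.single a b + p) = insert a (Poly_Mapping.keys p)"
      using single by (auto simp: in_keys_iff lookup_add lookup_single when_def split: if_splits)
    have a: "set (letters a) \<subseteq> A" and p: "p \<in> carrier (free_ring A)"
      using single(4) unfolding free_ring_def by (simp_all add: keys)
    have "Poly_Mapping.single a b = Poly_Mapping.single 0 b * Poly_Mapping.single (Word (letters a)) 1"
      by (simp add: mult_single)
    then have "Poly_Mapping.single a b \<in> D" using Dmult[OF Dint Dword[OF a]] by simp
    then show ?case using single(3)[OF p] Dadd by simp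
  qed
  with p show ?thesis by (simp add: D_def)
qed

definition word_eval :: "('b, 'm) ring_scheme \<Rightarrow> ('a \<Rightarrow> 'b) \<Rightarrow> 'a word \<Rightarrow> 'b" where
  "word_eval T \<phi> w = foldr (\<lambda>x a. \<phi> x \<otimes>\<^bsub>T\<^esub> a) (letters w) \<one>\<^bsub>T\<^esub>"

definition free_eval :: "('b, 'm) ring_scheme \<Rightarrow> ('a \<Rightarrow> 'b) \<Rightarrow> ('a word \<Rightarrow>\<^sub>0 int) \<Rightarrow> 'b" where
  "free_eval T \<phi> p = finsum T (\<lambda>w. [Poly_Mapping.lookup p w] \<cdot>\<^bsub>T\<^esub> word_eval T \<phi> w) (Poly_Mapping.keys p)"

locale evaluation = ring T for T (structure) +
  fixes \<phi> :: "'a \<Rightarrow> 'b"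
  assumes val: "\<phi> x \<in> carrier T"
begin

abbreviation "W \<equiv> word_eval T \<phi>"
abbreviation "ev \<equiv> free_eval T \<phi>"

lemma W_closed [simp]: "W w \<in> carrier T"
proof -
  have "foldr (\<lambda>x a. \<phi> x \<otimes> a) l \<one> \<in> carrier T" for l
    by (induction l) (use val in auto)
  then show ?thesis by (simp add: word_eval_def)
qed

lemma W_add: "W (v + w) = W v \<otimes> W w"
proof -
  have "foldr (\<lambda>x a. \<phi> x \<otimes> a) (l @ m) \<one> = foldr (\<lambda>x a. \<phi> x \<otimes> a) l \<one> \<otimes> foldr (\<lambda>x a. \<phi> x \<otimes> a) m \<one>" for l m
  proof (induction l)
    case Nil
    show ?case using W_closed[of "Word m"] by (simp add: word_eval_def)
  next
    case (Cons a l)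
    then show ?case
      using W_closed[of "Word l"] W_closed[of "Word m"] val by (simp add: word_eval_def m_assoc)
  qed
  then show ?thesis by (simp add: word_eval_def plus_word_def)
qed

lemma ip_closed [simp]: "[(k::int)] \<cdot> W w \<in> carrier T"
  by (simp add: add.int_pow_closed)

lemma ev_closed [simp]: "ev p \<in> carrier T"
  unfolding free_eval_def by (rule finsum_closed) auto

lemma zero_pow: "[(0::int)] \<cdot> x = \<zero>"
  by (simp add: add_pow_def)

lemma ev_superset:
  assumes "finite B" "Poly_Mapping.keys p \<subseteq> B"
  shows "ev p = (\<Oplus>w \<in> B. [Poly_Mapping.lookup p w] \<cdot> W w)"
  unfolding free_eval_def
  by (rule add.finprod_mono_neutral_cong_left) (use assms zero_pow in \<open>auto simp: in_keys_iff\<close>)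

lemma ev_add: "ev (p + q) = ev p \<oplus> ev q"
proof -
  let ?B = "Poly_Mapping.keys p \<union> Poly_Mapping.keys q"
  have "ev (p + q) = (\<Oplus>w \<in> ?B. [Poly_Mapping.lookup (p + q) w] \<cdot> W w)"
    by (rule ev_superset) (use keys_add[of p q] in auto)
  also have "\<dots> = (\<Oplus>w \<in> ?B. [Poly_Mapping.lookup p w] \<cdot> W w \<oplus> [Poly_Mapping.lookup q w] \<cdot> W w)"
    by (rule finsum_cong') (auto simp: lookup_add add.int_pow_mult)
  also have "\<dots> = (\<Oplus>w \<in> ?B. [Poly_Mapping.lookup p w] \<cdot> W w) \<oplus> (\<Oplus>w \<in> ?B. [Poly_Mapping.lookup q w] \<cdot> W w)"
    by (rule finsum_addf) auto
  also have "\<dots> = ev p \<oplus> ev q"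
    by (simp add: ev_superset[of ?B p] ev_superset[of ?B q])
  finally show ?thesis .
qed

lemma ev_zero [simp]: "ev 0 = \<zero>"
  by (simp add: free_eval_def)

lemma ev_single: "ev (Poly_Mapping.single w k) = [k] \<cdot> W w"
  using ev_superset[of "{w}" "Poly_Mapping.single w k"] by (simp add: lookup_single)

lemma ev_mult: "ev (p * q) = ev p \<otimes> ev q"
proof (induction p rule: pm_split_induct)
  case zero show ?case by simp
next
  case (single v k p)
  have "ev (Poly_Mapping.single v k * q) = ([k] \<cdot> W v) \<otimes> ev q"
  proof (induction q rule: pm_split_induct)
    case zero show ?case by simp
  next
    case (single w l q)
    have "ev (Poly_Mapping.single v k * Poly_Mapping.single w l) = ([k] \<cdot> W v) \<otimes> ([l] \<cdot> W w)"
      by (simp add: mult_single ev_single W_add add_pow_ldistr_int add_pow_rdistr_int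
          add.int_pow_pow mult.commute)
    then show ?case using single by (simp add: distrib_left ev_add r_distr ev_single)
  qed
  then show ?case using single by (simp add: distrib_right ev_add l_distr ev_single)
qed

lemma W_zero: "W 0 = \<one>"
  by (simp add: word_eval_def zero_word_def)

lemma one_pow: "x \<in> carrier T \<Longrightarrow> [(1::int)] \<cdot> x = x"
  by simp

lemma ev_one [simp]: "ev 1 = \<one>"
  using ev_single[of 0 1] by (simp add: W_zero)

lemma ev_gen [simp]: "ev (gen x) = \<phi> x"
  using val by (simp add: gen_def ev_single word_eval_def)

lemma ev_uminus: "ev (- p) = \<ominus> ev p"
  using ev_add[of "- p" p] by (intro minus_equality[symmetric]) auto

lemma ev_diff: "ev (p - q) = ev p \<ominus> ev q"
  using ev_add[of p "- q"] by (simp add: ev_uminus a_minus_def)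

lemma ev_hom: "ev \<in> ring_hom (free_ring A) T"
  by (rule ring_hom_memI) (auto simp: ev_mult ev_add)

end

locale presentation =
  fixes A :: "'a set" and E :: "('a word \<Rightarrow>\<^sub>0 int) set"
  assumes E_sub: "E \<subseteq> carrier (free_ring A)"
begin

abbreviation "F \<equiv> free_ring A"
abbreviation "I \<equiv> genideal F E"
abbreviation "P \<equiv> presented_ring A E"
abbreviation "c \<equiv> cls A E"

sublocale F: ring F by (rule ring_free_ring)
sublocale I: ideal I F by (rule F.genideal_ideal[OF E_sub])
sublocale P: ring P unfolding presented_ring_def by (rule I.quotient_is_ring)

lemma cls_hom: "c \<in> ring_hom F P"
  using I.rcos_ring_hom unfolding cls_def presented_ring_def .

sublocale c: ring_hom_ring F P c
  by (intro ring_hom_ringI2 F.ring_axioms P.ring_axioms cls_hom)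

lemma cls_simps:
  assumes "p \<in> carrier F" "q \<in> carrier F"
  shows "c (p + q) = c p \<oplus>\<^bsub>P\<^esub> c q" "c (p * q) = c p \<otimes>\<^bsub>P\<^esub> c q"
  using c.hom_add[OF assms] c.hom_mult[OF assms] by simp_all

lemma cls_one: "c 1 = \<one>\<^bsub>P\<^esub>"
  using c.hom_one by simp

lemma cls_zero: "c 0 = \<zero>\<^bsub>P\<^esub>"
  using c.hom_zero by simp

lemma cls_rel0: "e \<in> E \<Longrightarrow> c e = \<zero>\<^bsub>P\<^esub>"
  using F.genideal_self[OF E_sub] I.a_rcos_const[of e]
  unfolding cls_def presented_ring_def FactRing_def by auto

lemma cls_rel: "p - q \<in> E \<Longrightarrow> p \<in> carrier F \<Longrightarrow> q \<in> carrier F \<Longrightarrow> c p = c q"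
  using cls_simps(1)[of "p - q" q] cls_rel0[of "p - q"] E_sub by (auto simp: c.hom_closed)

lemma carrier_cls: "carrier P = c ` carrier F"
  by (auto simp: presented_ring_def cls_def FactRing_def A_RCOSETS_def')

lemma cls_mem: "x \<in> c p \<Longrightarrow> \<exists>i \<in> I. x = i + p"
  by (simp add: cls_def a_r_coset_def')

lemma hom_unique:
  assumes T: "ring T" and h: "h \<in> ring_hom P T" and k: "k \<in> ring_hom P T"
    and eq: "\<And>x. x \<in> A \<Longrightarrow> h (c (gen x)) = k (c (gen x))" and a: "a \<in> carrier P"
  shows "h a = k a"
proof -
  obtain p where p: "p \<in> carrier F" "a = c p" using a unfolding carrier_cls by auto
  have "(h \<circ> c) p = (k \<circ> c) p"
    by (rule free_hom_unique[OF T ring_hom_trans[OF cls_hom h] ring_hom_trans[OF cls_hom k]])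
      (use eq p in auto)
  then show ?thesis by (simp add: p)
qed

lemma hom_exists:
  assumes T: "ring T" and val: "\<And>x. \<phi> x \<in> carrier T"
    and rels: "\<And>e. e \<in> E \<Longrightarrow> free_eval T \<phi> e = \<zero>\<^bsub>T\<^esub>"
  obtains h where "h \<in> ring_hom P T" "h \<in> extensional (carrier P)" "\<And>x. x \<in> A \<Longrightarrow> h (c (gen x)) = \<phi> x"
proof -
  interpret evaluation T \<phi> by (intro evaluation.intro evaluation_axioms.intro T val)
  interpret e: ring_hom_ring F T ev
    by (intro ring_hom_ringI2 F.ring_axioms T ev_hom)
  have "E \<subseteq> a_kernel F T ev"
    unfolding a_kernel_def' using E_sub rels by blast
  then have ker: "I \<subseteq> a_kernel F T ev"
    by (rule F.genideal_minimal[OF e.kernel_is_ideal])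
  have I0: "ev i = \<zero>\<^bsub>T\<^esub>" if "i \<in> I" for i
    using subsetD[OF ker that] by (rule e.kernel_zero)
  have img: "ev ` c p = {ev p}" if p: "p \<in> carrier F" for p
  proof -
    have "ev x = ev p" if x: "x \<in> c p" for x
    proof -
      obtain i where "i \<in> I" "x = i + p" using cls_mem[OF x] by blast
      then show ?thesis using I0 by (simp add: ev_add)
    qed
    moreover have "p \<in> c p" using I.a_rcos_self[OF p] by (simp add: cls_def)
    ultimately show ?thesis by blast
  qed
  define h where "h = restrict (\<lambda>C. the_elem (ev ` C)) (carrier P)"
  have h: "h (c p) = ev p" if "p \<in> carrier F" for p
    unfolding h_def restrict_apply using img[OF that] c.hom_closed[OF that] by (simp only: if_True the_elem_eq)
  have "h \<in> ring_hom P T"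
  proof (rule ring_hom_memI)
    fix a b assume "a \<in> carrier P" "b \<in> carrier P"
    then obtain p q where pq: "p \<in> carrier F" "a = c p" "q \<in> carrier F" "b = c q"
      unfolding carrier_cls by auto
    then show "h a \<in> carrier T" by (simp add: h)
    show "h (a \<otimes>\<^bsub>P\<^esub> b) = h a \<otimes>\<^bsub>T\<^esub> h b"
      using pq by (simp add: h ev_mult flip: cls_simps)
    show "h (a \<oplus>\<^bsub>P\<^esub> b) = h a \<oplus>\<^bsub>T\<^esub> h b"
      using pq by (simp add: h ev_add flip: cls_simps)
  next
    show "h \<one>\<^bsub>P\<^esub> = \<one>\<^bsub>T\<^esub>" using h[of 1] by (simp add: cls_one)
  qed
  moreover have "h \<in> extensional (carrier P)" by (simp add: h_def)
  moreover have "h (c (gen x)) = \<phi> x" if "x \<in> A" for x using that by (simp add: h)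
  ultimately show thesis by (rule that)
qed

end

lemma inv_via_gens:
  assumes "ring T" "a \<in> carrier T" "b \<in> carrier T" "a \<otimes>\<^bsub>T\<^esub> b = \<one>\<^bsub>T\<^esub>" "b \<otimes>\<^bsub>T\<^esub> a = \<one>\<^bsub>T\<^esub>"
  shows "a \<in> Units T" "inv\<^bsub>T\<^esub> a = b"
proof -
  interpret ring T by fact
  show "a \<in> Units T" using assms by (auto simp: Units_def)
  show "inv\<^bsub>T\<^esub> a = b" using inv_unique'[of a b] assms by simp
qed

lemma inv_mult_units:
  assumes "ring T" "a \<in> Units T" "b \<in> Units T"
  shows "inv\<^bsub>T\<^esub> (a \<otimes>\<^bsub>T\<^esub> b) = inv\<^bsub>T\<^esub> b \<otimes>\<^bsub>T\<^esub> inv\<^bsub>T\<^esub> a"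
proof -
  interpret T: ring T by fact
  have c: "a \<in> carrier T" "b \<in> carrier T" "inv\<^bsub>T\<^esub> a \<in> carrier T" "inv\<^bsub>T\<^esub> b \<in> carrier T"
    using assms by (auto simp: T.Units_closed)
  have "(a \<otimes>\<^bsub>T\<^esub> b) \<otimes>\<^bsub>T\<^esub> (inv\<^bsub>T\<^esub> b \<otimes>\<^bsub>T\<^esub> inv\<^bsub>T\<^esub> a) = a \<otimes>\<^bsub>T\<^esub> ((b \<otimes>\<^bsub>T\<^esub> inv\<^bsub>T\<^esub> b) \<otimes>\<^bsub>T\<^esub> inv\<^bsub>T\<^esub> a)"
    "(inv\<^bsub>T\<^esub> b \<otimes>\<^bsub>T\<^esub> inv\<^bsub>T\<^esub> a) \<otimes>\<^bsub>T\<^esub> (a \<otimes>\<^bsub>T\<^esub> b) = inv\<^bsub>T\<^esub> b \<otimes>\<^bsub>T\<^esub> ((inv\<^bsub>T\<^esub> a \<otimes>\<^bsub>T\<^esub> a) \<otimes>\<^bsub>T\<^esub> b)"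
    using c by (simp_all add: T.m_assoc del: T.Units_r_inv T.Units_l_inv)
  then show ?thesis using assms(2,3) c by (intro inv_via_gens(2)[OF assms(1)]) auto
qed

lemma ring_add_eqD:
  assumes "ring T" "a \<in> carrier T" "b \<in> carrier T" "c \<in> carrier T" "a \<oplus>\<^bsub>T\<^esub> b = c"
  shows "a = c \<ominus>\<^bsub>T\<^esub> b"
proof -
  interpret T: ring T by fact
  have "c \<ominus>\<^bsub>T\<^esub> b = a \<oplus>\<^bsub>T\<^esub> (b \<oplus>\<^bsub>T\<^esub> \<ominus>\<^bsub>T\<^esub> b)"
    using assms(2-4) by (simp add: a_minus_def T.a_assoc flip: assms(5))
  then show ?thesis using assms by (simp add: T.r_neg)
qed

lemma ring_minus_self: "ring T \<Longrightarrow> a \<in> carrier T \<Longrightarrow> a \<ominus>\<^bsub>T\<^esub> a = \<zero>\<^bsub>T\<^esub>"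
  by (simp add: a_minus_def abelian_group.r_neg ring.is_abelian_group)

lemma if_closed: "(Q \<Longrightarrow> a \<in> C) \<Longrightarrow> (\<not> Q \<Longrightarrow> b \<in> C) \<Longrightarrow> (if Q then a else b) \<in> C"
  by simp

lemma hom_inv:
  assumes "ring R" "ring T" "h \<in> ring_hom R T" "a \<in> Units R"
  shows "h (inv\<^bsub>R\<^esub> a) = inv\<^bsub>T\<^esub> (h a)"
proof -
  interpret R: ring R by fact
  have "h a \<otimes>\<^bsub>T\<^esub> h (inv\<^bsub>R\<^esub> a) = \<one>\<^bsub>T\<^esub>" "h (inv\<^bsub>R\<^esub> a) \<otimes>\<^bsub>T\<^esub> h a = \<one>\<^bsub>T\<^esub>"
    using assms(4) ring_hom_mult[OF assms(3), of a "inv\<^bsub>R\<^esub> a"] ring_hom_mult[OF assms(3), of "inv\<^bsub>R\<^esub> a" a]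
      ring_hom_one[OF assms(3)] by (auto simp: R.Units_closed)
  then show ?thesis
    using inv_via_gens(2)[OF assms(2), of "h a" "h (inv\<^bsub>R\<^esub> a)"] assms(4)
    by (simp add: ring_hom_closed[OF assms(3)] R.Units_closed)
qed

subsection \<open>Relations in the two rings\<close>

locale group_pair = group G for G (structure) +
  fixes H
  assumes sub: "subgroup H G"
begin

abbreviation "D \<equiv> carrier G - H"
abbreviation "A' \<equiv> AG_ring G H"
abbreviation "R \<equiv> R_ring G H"
abbreviation "u \<equiv> u_elt G H"
abbreviation "s \<equiv> s_elt G H"
abbreviation "v \<equiv> v_elt G H"

lemma H_carrier [simp]: "h \<in> H \<Longrightarrow> h \<in> carrier G"
  using subgroup.mem_carrier[OF sub] .

lemma H_mem [simp]: "\<one> \<in> H" "x \<in> H \<Longrightarrow> inv x \<in> H"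
  "x \<in> H \<Longrightarrow> y \<in> H \<Longrightarrow> x \<otimes> y \<in> H"
  using sub by (auto intro: subgroup.one_closed subgroup.m_inv_closed subgroup.m_closed)

lemma inv_H_iff [simp]: "x \<in> carrier G \<Longrightarrow> inv x \<in> H \<longleftrightarrow> x \<in> H"
  using H_mem(2)[of "inv x"] H_mem(2)[of x] by auto

lemma H_mult_iff [simp]:
  "h \<in> H \<Longrightarrow> x \<in> carrier G \<Longrightarrow> h \<otimes> x \<in> H \<longleftrightarrow> x \<in> H"
  "h \<in> H \<Longrightarrow> x \<in> carrier G \<Longrightarrow> x \<otimes> h \<in> H \<longleftrightarrow> x \<in> H"
proof -
  assume h: "h \<in> H" and x: "x \<in> carrier G"
  have "inv h \<otimes> (h \<otimes> x) = x" "(x \<otimes> h) \<otimes> inv h = x"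
    using h x by (simp_all add: inv_solve_left' inv_solve_right' m_assoc[symmetric])
  then show "h \<otimes> x \<in> H \<longleftrightarrow> x \<in> H" "x \<otimes> h \<in> H \<longleftrightarrow> x \<in> H"
    using h by (metis H_mem(2,3))+
qed

sublocale A: presentation "AG_gens G H" "AG_rels G H"
proof
  show "AG_rels G H \<subseteq> carrier (free_ring (AG_gens G H))"
    unfolding AG_rels_def by (auto intro!: free_closed simp: AG_gens_def)
qed

sublocale B: presentation "R_gens G H" "R_rels G H"
proof
  show "R_rels G H \<subseteq> carrier (free_ring (R_gens G H))"
    unfolding R_rels_def by (auto intro!: free_closed simp: R_gens_def)
qed

sublocale AR: ring A' unfolding AG_ring_def by (rule A.P.ring_axioms)
sublocale RR: ring R unfolding R_ring_def by (rule B.P.ring_axioms)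

lemma AG_relsI:
  assumes "x \<in> D" "y \<in> D"
  shows "gen (Ugen x y) * gen (Uinv x y) - 1 \<in> AG_rels G H"
    and "gen (Uinv x y) * gen (Ugen x y) - 1 \<in> AG_rels G H"
    and "z \<in> D \<Longrightarrow> gen (Ugen x y) * gen (Ugen y z) - gen (Ugen x z) \<in> AG_rels G H"
    and "h \<in> H \<Longrightarrow> gen (Ugen (x \<otimes> h) y) - gen (Ugen x y) \<in> AG_rels G H"
    and "h \<in> H \<Longrightarrow> gen (Ugen x (y \<otimes> h)) - gen (Ugen x y) \<in> AG_rels G H"
    and "h \<in> H \<Longrightarrow> gen (Ugen (h \<otimes> x) (h \<otimes> y)) - gen (Ugen x y) \<in> AG_rels G H"
    and "inv y \<otimes> x \<notin> H \<Longrightarrow> gen (Ugen (inv y \<otimes> x) (inv y)) + gen (Ugen x y) - 1 \<in> AG_rels G H"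
  unfolding AG_rels_def using assms by blast+

lemma R_relsI:
  shows "gen (Sgen \<one>) - 1 \<in> R_rels G H"
    and "x \<in> carrier G \<Longrightarrow> y \<in> carrier G \<Longrightarrow>
      gen (Sgen x) * gen (Sgen y) - gen (Sgen (x \<otimes> y)) \<in> R_rels G H"
    and "x \<in> H \<Longrightarrow> gen (Vgen x) \<in> R_rels G H"
    and "x \<in> D \<Longrightarrow> gen (Vgen x) * gen (Vinv x) - 1 \<in> R_rels G H"
    and "x \<in> D \<Longrightarrow> gen (Vinv x) * gen (Vgen x) - 1 \<in> R_rels G H"
    and "x \<in> carrier G \<Longrightarrow> y \<in> carrier G \<Longrightarrow>
      gen (Vgen (x \<otimes> y)) - (gen (Vgen y) + gen (Vgen x) * gen (Sgen y)) \<in> R_rels G H"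
  unfolding R_rels_def by blast+

lemma U_gens [simp]: "x \<in> D \<Longrightarrow> y \<in> D \<Longrightarrow> Ugen x y \<in> AG_gens G H"
  "x \<in> D \<Longrightarrow> y \<in> D \<Longrightarrow> Uinv x y \<in> AG_gens G H"
  by (auto simp: AG_gens_def)

lemma u_closed [simp]: "x \<in> D \<Longrightarrow> y \<in> D \<Longrightarrow> u x y \<in> carrier A'"
  unfolding u_elt_def AG_ring_def by (rule A.c.hom_closed) simp

lemma u_inv:
  assumes "x \<in> D" "y \<in> D"
  shows "u x y \<in> Units A'" "inv\<^bsub>A'\<^esub> u x y = cls (AG_gens G H) (AG_rels G H) (gen (Uinv x y))"
proof -
  have "cls (AG_gens G H) (AG_rels G H) (gen (Ugen x y) * gen (Uinv x y)) = A.c 1"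
    "cls (AG_gens G H) (AG_rels G H) (gen (Uinv x y) * gen (Ugen x y)) = A.c 1"
    using assms by (intro A.cls_rel AG_relsI; simp)+
  then have eq: "u x y \<otimes>\<^bsub>A'\<^esub> A.c (gen (Uinv x y)) = \<one>\<^bsub>A'\<^esub>" "A.c (gen (Uinv x y)) \<otimes>\<^bsub>A'\<^esub> u x y = \<one>\<^bsub>A'\<^esub>"
    using assms unfolding u_elt_def AG_ring_def by (simp_all add: A.cls_simps A.cls_one)
  have "A.c (gen (Uinv x y)) \<in> carrier A'"
    unfolding AG_ring_def using assms by (intro A.c.hom_closed) simp
  with eq show "u x y \<in> Units A'" "inv\<^bsub>A'\<^esub> u x y = A.c (gen (Uinv x y))"
    using inv_via_gens[OF AR.ring_axioms] assms by auto
qed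

lemma u_trans:
  assumes "x \<in> D" "y \<in> D" "z \<in> D" shows "u x y \<otimes>\<^bsub>A'\<^esub> u y z = u x z"
proof -
  have "A.c (gen (Ugen x y) * gen (Ugen y z)) = A.c (gen (Ugen x z))"
    using assms by (intro A.cls_rel AG_relsI; simp)
  then show ?thesis using assms unfolding u_elt_def AG_ring_def by (simp add: A.cls_simps)
qed

lemma u_H:
  assumes "x \<in> D" "y \<in> D" "h \<in> H"
  shows "u (x \<otimes> h) y = u x y" "u x (y \<otimes> h) = u x y" "u (h \<otimes> x) (h \<otimes> y) = u x y"
  unfolding u_elt_def
  using assms by (intro A.cls_rel AG_relsI; simp)+

lemma u_add:
  assumes "x \<in> D" "y \<in> D" "inv y \<otimes> x \<notin> H"
  shows "u (inv y \<otimes> x) (inv y) \<oplus>\<^bsub>A'\<^esub> u x y = \<one>\<^bsub>A'\<^esub>"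
proof -
  have "A.c (gen (Ugen (inv y \<otimes> x) (inv y)) + gen (Ugen x y)) = A.c 1"
    using assms by (intro A.cls_rel AG_relsI; simp)
  then show ?thesis using assms unfolding u_elt_def AG_ring_def
    by (simp add: A.cls_simps A.cls_one)
qed

lemma u_refl [simp]: assumes "x \<in> D" shows "u x x = \<one>\<^bsub>A'\<^esub>"
proof -
  have "u x x \<otimes>\<^bsub>A'\<^esub> u x x = u x x \<otimes>\<^bsub>A'\<^esub> \<one>\<^bsub>A'\<^esub>" using assms by (simp add: u_trans)
  then show ?thesis using AR.Units_l_cancel[OF u_inv(1)[OF assms assms], of "u x x" "\<one>\<^bsub>A'\<^esub>"] assms by simp
qed

lemma u_inv_eq: assumes "x \<in> D" "y \<in> D" shows "inv\<^bsub>A'\<^esub> u x y = u y x"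
  using inv_via_gens(2)[OF AR.ring_axioms, of "u x y" "u y x"] assms by (simp add: u_trans)

lemma SV_gens [simp]: "x \<in> carrier G \<Longrightarrow> Sgen x \<in> R_gens G H" "x \<in> carrier G \<Longrightarrow> Vgen x \<in> R_gens G H"
  "x \<in> D \<Longrightarrow> Vinv x \<in> R_gens G H"
  by (auto simp: R_gens_def)

lemma sv_closed [simp]: "x \<in> carrier G \<Longrightarrow> s x \<in> carrier R" "x \<in> carrier G \<Longrightarrow> v x \<in> carrier R"
  unfolding s_elt_def v_elt_def R_ring_def by (auto intro!: B.c.hom_closed)

lemma v_inv:
  assumes "x \<in> D"
  shows "v x \<in> Units R" "inv\<^bsub>R\<^esub> v x = cls (R_gens G H) (R_rels G H) (gen (Vinv x))"
proof -
  have "B.c (gen (Vgen x) * gen (Vinv x)) = B.c 1" "B.c (gen (Vinv x) * gen (Vgen x)) = B.c 1"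
    using assms by (intro B.cls_rel R_relsI; simp)+
  then have eq: "v x \<otimes>\<^bsub>R\<^esub> B.c (gen (Vinv x)) = \<one>\<^bsub>R\<^esub>" "B.c (gen (Vinv x)) \<otimes>\<^bsub>R\<^esub> v x = \<one>\<^bsub>R\<^esub>"
    using assms unfolding v_elt_def R_ring_def by (simp_all add: B.cls_simps B.cls_one)
  have "B.c (gen (Vinv x)) \<in> carrier R"
    unfolding R_ring_def using assms by (intro B.c.hom_closed) simp
  with eq show "v x \<in> Units R" "inv\<^bsub>R\<^esub> v x = B.c (gen (Vinv x))"
    using inv_via_gens[OF RR.ring_axioms] assms by auto
qed

lemma s_one [simp]: "s \<one> = \<one>\<^bsub>R\<^esub>"
proof -
  have "B.c (gen (Sgen \<one>)) = B.c 1" by (intro B.cls_rel R_relsI; simp)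
  then show ?thesis unfolding s_elt_def R_ring_def by (simp add: B.cls_one)
qed

lemma s_mult:
  assumes "x \<in> carrier G" "y \<in> carrier G" shows "s x \<otimes>\<^bsub>R\<^esub> s y = s (x \<otimes> y)"
proof -
  have "B.c (gen (Sgen x) * gen (Sgen y)) = B.c (gen (Sgen (x \<otimes> y)))"
    using assms by (intro B.cls_rel R_relsI; simp)
  then show ?thesis using assms unfolding s_elt_def R_ring_def by (simp add: B.cls_simps)
qed

lemma v_H [simp]: "x \<in> H \<Longrightarrow> v x = \<zero>\<^bsub>R\<^esub>"
  unfolding v_elt_def R_ring_def by (rule B.cls_rel0) (rule R_relsI)

lemma v_mult:
  assumes "x \<in> carrier G" "y \<in> carrier G" shows "v (x \<otimes> y) = v y \<oplus>\<^bsub>R\<^esub> v x \<otimes>\<^bsub>R\<^esub> s y"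
proof -
  have "B.c (gen (Vgen (x \<otimes> y))) = B.c (gen (Vgen y) + gen (Vgen x) * gen (Sgen y))"
    using assms by (intro B.cls_rel R_relsI; simp)
  then show ?thesis using assms unfolding s_elt_def v_elt_def R_ring_def by (simp add: B.cls_simps)
qed

lemma s_unit:
  assumes "x \<in> carrier G" shows "s x \<in> Units R" "inv\<^bsub>R\<^esub> s x = s (inv x)"
  using inv_via_gens[OF RR.ring_axioms, of "s x" "s (inv x)"] assms by (simp_all add: s_mult)

text \<open>Two homomorphisms agreeing on the elements \<open>u x y\<close>, resp. \<open>s x\<close> and \<open>v x\<close>, are equal.\<close>

lemma AG_hom_unique:
  assumes T: "ring T" and h: "h \<in> ring_hom A' T" "h \<in> extensional (carrier A')"
    and k: "k \<in> ring_hom A' T" "k \<in> extensional (carrier A')"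
    and eq: "\<And>x y. x \<in> D \<Longrightarrow> y \<in> D \<Longrightarrow> h (u x y) = k (u x y)"
  shows "h = k"
proof (rule extensionalityI[OF h(2) k(2)])
  fix a assume a: "a \<in> carrier A'"
  show "h a = k a"
  proof (rule A.hom_unique[OF T, folded AG_ring_def, OF h(1) k(1) _ a])
    fix z assume "z \<in> AG_gens G H"
    then consider x y where "x \<in> D" "y \<in> D" "z = Ugen x y" | x y where "x \<in> D" "y \<in> D" "z = Uinv x y"
      by (auto simp: AG_gens_def)
    then show "h (A.c (gen z)) = k (A.c (gen z))"
    proof cases
      case 1 then show ?thesis using eq by (simp add: u_elt_def)
    next
      case (2 x y)
      then show ?thesis
        using hom_inv[OF AR.ring_axioms T h(1) u_inv(1)] hom_inv[OF AR.ring_axioms T k(1) u_inv(1)] eq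
        by (simp flip: u_inv(2))
    qed
  qed
qed

lemma R_hom_unique:
  assumes T: "ring T" and h: "h \<in> ring_hom R T" "h \<in> extensional (carrier R)"
    and k: "k \<in> ring_hom R T" "k \<in> extensional (carrier R)"
    and eq: "\<And>x. x \<in> carrier G \<Longrightarrow> h (s x) = k (s x)" "\<And>x. x \<in> carrier G \<Longrightarrow> h (v x) = k (v x)"
  shows "h = k"
proof (rule extensionalityI[OF h(2) k(2)])
  fix a assume a: "a \<in> carrier R"
  show "h a = k a"
  proof (rule B.hom_unique[OF T, folded R_ring_def, OF h(1) k(1) _ a])
    fix z assume "z \<in> R_gens G H"
    then consider x where "x \<in> carrier G" "z = Sgen x" | x where "x \<in> carrier G" "z = Vgen x"
      | x where "x \<in> D" "z = Vinv x"
      by (auto simp: R_gens_def)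
    then show "h (B.c (gen z)) = k (B.c (gen z))"
    proof cases
      case 1 then show ?thesis using eq by (simp add: s_elt_def)
    next
      case 2 then show ?thesis using eq by (simp add: v_elt_def)
    next
      case (3 x)
      then show ?thesis
        using hom_inv[OF RR.ring_axioms T h(1) v_inv(1)] hom_inv[OF RR.ring_axioms T k(1) v_inv(1)] eq
        by (simp flip: v_inv(2))
    qed
  qed
qed

subsection \<open>The homomorphism \<open>q\<close>\<close>

lemma v_inv_left:
  assumes x: "x \<in> carrier G" shows "v x \<oplus>\<^bsub>R\<^esub> v (inv x) \<otimes>\<^bsub>R\<^esub> s x = \<zero>\<^bsub>R\<^esub>"
  using v_mult[of "inv x" x] x by simp

lemma s_v_inv:
  assumes y: "y \<in> D" shows "s y \<otimes>\<^bsub>R\<^esub> inv\<^bsub>R\<^esub> v y = \<ominus>\<^bsub>R\<^esub> (inv\<^bsub>R\<^esub> v (inv y))"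
proof -
  have iy: "inv y \<in> D" using y by simp
  have c: "inv\<^bsub>R\<^esub> v y \<in> carrier R" "inv\<^bsub>R\<^esub> v (inv y) \<in> carrier R" "s y \<in> carrier R" "v y \<in> carrier R"
      "v (inv y) \<in> carrier R"
    using v_inv(1)[OF y] v_inv(1)[OF iy] y by auto
  have "inv\<^bsub>R\<^esub> v (inv y) \<otimes>\<^bsub>R\<^esub> ((v y \<oplus>\<^bsub>R\<^esub> v (inv y) \<otimes>\<^bsub>R\<^esub> s y) \<otimes>\<^bsub>R\<^esub> inv\<^bsub>R\<^esub> v y) = \<zero>\<^bsub>R\<^esub>"
    using v_inv_left[of y] y c by simp
  moreover have "inv\<^bsub>R\<^esub> v (inv y) \<otimes>\<^bsub>R\<^esub> ((v y \<oplus>\<^bsub>R\<^esub> v (inv y) \<otimes>\<^bsub>R\<^esub> s y) \<otimes>\<^bsub>R\<^esub> inv\<^bsub>R\<^esub> v y)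
    = inv\<^bsub>R\<^esub> v (inv y) \<otimes>\<^bsub>R\<^esub> (v y \<otimes>\<^bsub>R\<^esub> inv\<^bsub>R\<^esub> v y)
      \<oplus>\<^bsub>R\<^esub> (inv\<^bsub>R\<^esub> v (inv y) \<otimes>\<^bsub>R\<^esub> v (inv y)) \<otimes>\<^bsub>R\<^esub> (s y \<otimes>\<^bsub>R\<^esub> inv\<^bsub>R\<^esub> v y)"
    using c by (simp add: RR.l_distr RR.r_distr RR.m_assoc)
  ultimately have "inv\<^bsub>R\<^esub> v (inv y) \<oplus>\<^bsub>R\<^esub> s y \<otimes>\<^bsub>R\<^esub> inv\<^bsub>R\<^esub> v y = \<zero>\<^bsub>R\<^esub>"
    using v_inv(1)[OF y] v_inv(1)[OF iy] c by simp
  then have "s y \<otimes>\<^bsub>R\<^esub> inv\<^bsub>R\<^esub> v y \<oplus>\<^bsub>R\<^esub> inv\<^bsub>R\<^esub> v (inv y) = \<zero>\<^bsub>R\<^esub>"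
    using c by (simp add: RR.a_comm)
  then show ?thesis using c by (intro RR.minus_equality[symmetric]) auto
qed

definition qv :: "'a \<Rightarrow> 'a \<Rightarrow> ('a sv_gen word \<Rightarrow>\<^sub>0 int) set" where
  "qv x y = v (inv x) \<otimes>\<^bsub>R\<^esub> inv\<^bsub>R\<^esub> v (inv y)"

lemma qv_closed [simp]: "x \<in> D \<Longrightarrow> y \<in> D \<Longrightarrow> qv x y \<in> carrier R"
  using v_inv(1)[of "inv y"] by (simp add: qv_def)

lemma qv_trans: assumes "x \<in> D" "y \<in> D" "z \<in> D" shows "qv x y \<otimes>\<^bsub>R\<^esub> qv y z = qv x z"
proof -
  have U: "v (inv x) \<in> Units R" "v (inv y) \<in> Units R" "v (inv z) \<in> Units R"
    using assms by (auto intro: v_inv(1))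
  then have "qv x y \<otimes>\<^bsub>R\<^esub> qv y z = v (inv x) \<otimes>\<^bsub>R\<^esub> ((inv\<^bsub>R\<^esub> v (inv y) \<otimes>\<^bsub>R\<^esub> v (inv y)) \<otimes>\<^bsub>R\<^esub> inv\<^bsub>R\<^esub> v (inv z))"
    unfolding qv_def by (simp add: RR.m_assoc RR.Units_closed del: RR.Units_l_inv)
  also have "\<dots> = qv x z" using U by (simp add: qv_def)
  finally show ?thesis .
qed

lemma qv_refl: "x \<in> D \<Longrightarrow> qv x x = \<one>\<^bsub>R\<^esub>"
  using v_inv(1)[of "inv x"] by (simp add: qv_def)

lemma v_Hmult:
  assumes "x \<in> carrier G" "h \<in> H" shows "v (h \<otimes> x) = v x" "v (x \<otimes> h) = v x \<otimes>\<^bsub>R\<^esub> s h"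
  using assms by (simp_all add: v_mult)

lemma qv_H:
  assumes "x \<in> D" "y \<in> D" "h \<in> H"
  shows "qv (x \<otimes> h) y = qv x y" "qv x (y \<otimes> h) = qv x y" "qv (h \<otimes> x) (h \<otimes> y) = qv x y"
proof -
  show "qv (x \<otimes> h) y = qv x y" "qv x (y \<otimes> h) = qv x y"
    using assms by (simp_all add: qv_def inv_mult_group v_Hmult)
  have U: "v (inv x) \<in> Units R" "v (inv y) \<in> Units R" "s (inv h) \<in> Units R"
    using assms by (auto intro: v_inv(1) s_unit(1))
  have "qv (h \<otimes> x) (h \<otimes> y) = (v (inv x) \<otimes>\<^bsub>R\<^esub> s (inv h)) \<otimes>\<^bsub>R\<^esub> (inv\<^bsub>R\<^esub> s (inv h) \<otimes>\<^bsub>R\<^esub> inv\<^bsub>R\<^esub> v (inv y))"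
    using assms U by (simp add: qv_def inv_mult_group v_Hmult inv_mult_units[OF RR.ring_axioms])
  also have "\<dots> = v (inv x) \<otimes>\<^bsub>R\<^esub> ((s (inv h) \<otimes>\<^bsub>R\<^esub> inv\<^bsub>R\<^esub> s (inv h)) \<otimes>\<^bsub>R\<^esub> inv\<^bsub>R\<^esub> v (inv y))"
    using U by (simp add: RR.m_assoc RR.Units_closed del: RR.Units_r_inv)
  also have "\<dots> = qv x y" using U by (simp add: qv_def)
  finally show "qv (h \<otimes> x) (h \<otimes> y) = qv x y" .
qed

lemma qv_add:
  assumes x: "x \<in> D" and y: "y \<in> D" and xy: "inv y \<otimes> x \<notin> H"
  shows "qv (inv y \<otimes> x) (inv y) \<oplus>\<^bsub>R\<^esub> qv x y = \<one>\<^bsub>R\<^esub>"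
proof -
  have U: "v (inv x) \<in> Units R" "v (inv y) \<in> Units R" "v y \<in> Units R"
    using assms by (auto intro: v_inv(1))
  have c: "inv\<^bsub>R\<^esub> v y \<in> carrier R" "inv\<^bsub>R\<^esub> v (inv y) \<in> carrier R" "s y \<in> carrier R" "v y \<in> carrier R"
      "v (inv x) \<in> carrier R"
    using U x y by auto
  have "qv (inv y \<otimes> x) (inv y) = (v y \<oplus>\<^bsub>R\<^esub> v (inv x) \<otimes>\<^bsub>R\<^esub> s y) \<otimes>\<^bsub>R\<^esub> inv\<^bsub>R\<^esub> v y"
    using x y by (simp add: qv_def inv_mult_group v_mult)
  also have "\<dots> = \<one>\<^bsub>R\<^esub> \<oplus>\<^bsub>R\<^esub> v (inv x) \<otimes>\<^bsub>R\<^esub> (s y \<otimes>\<^bsub>R\<^esub> inv\<^bsub>R\<^esub> v y)"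
    using U c by (simp add: RR.l_distr RR.m_assoc)
  also have "\<dots> = \<one>\<^bsub>R\<^esub> \<oplus>\<^bsub>R\<^esub> \<ominus>\<^bsub>R\<^esub> qv x y"
    using c by (simp add: s_v_inv[OF y] qv_def RR.r_minus)
  finally show ?thesis using x y by (simp add: RR.a_assoc RR.l_neg)
qed

lemma is_q_exists: "\<exists>q. is_q G H q"
proof -
  define \<phi> where "\<phi> z = (case z of
      Ugen x y \<Rightarrow> if x \<in> D \<and> y \<in> D then qv x y else \<zero>\<^bsub>R\<^esub>
    | Uinv x y \<Rightarrow> if x \<in> D \<and> y \<in> D then qv y x else \<zero>\<^bsub>R\<^esub>)" for z
  have val: "\<phi> z \<in> carrier R" for z by (simp add: \<phi>_def split: u_gen.split)
  interpret e: evaluation R \<phi> using val RR.ring_axioms by (simp add: evaluation_def evaluation_axioms_def)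
  have "free_eval R \<phi> e = \<zero>\<^bsub>R\<^esub>" if "e \<in> AG_rels G H" for e
    using that unfolding AG_rels_def Un_iff mem_Collect_eq
    by (elim disjE exE conjE) (simp_all add: e.ev_diff e.ev_mult e.ev_add \<phi>_def qv_trans qv_refl qv_H qv_add ring_minus_self[OF RR.ring_axioms])
  from A.hom_exists[OF RR.ring_axioms val this] obtain q where
    "q \<in> ring_hom (presented_ring (AG_gens G H) (AG_rels G H)) R"
    "q \<in> extensional (carrier (presented_ring (AG_gens G H) (AG_rels G H)))"
    "\<And>x. x \<in> AG_gens G H \<Longrightarrow> q (A.c (gen x)) = \<phi> x" by blast
  then have "is_q G H q"
    unfolding is_q_def AG_ring_def[symmetric] u_elt_def by (simp add: \<phi>_def qv_def)
  then show ?thesis by (rule exI[of _ q])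
qed

subsection \<open>The homomorphism \<open>f\<close>\<close>

context
  fixes g assumes g: "g \<in> D"
begin

definition fs :: "'a \<Rightarrow> ('a u_gen word \<Rightarrow>\<^sub>0 int) set" where
  "fs x = (if x \<in> H then u g (x \<otimes> g) else \<ominus>\<^bsub>A'\<^esub> (u g x \<otimes>\<^bsub>A'\<^esub> u (inv x) g))"

definition fv :: "'a \<Rightarrow> ('a u_gen word \<Rightarrow>\<^sub>0 int) set" where
  "fv x = (if x \<in> H then \<zero>\<^bsub>A'\<^esub> else u (inv x) g)"

lemma gD [simp]: "g \<in> carrier G" "g \<notin> H" using g by auto

lemma fs_closed [simp]: "x \<in> carrier G \<Longrightarrow> fs x \<in> carrier A'"
  and fv_closed [simp]: "x \<in> carrier G \<Longrightarrow> fv x \<in> carrier A'"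
  by (auto simp: fs_def fv_def)

lemma u_prod_H:
  assumes "x \<in> D" "y \<in> D" "x \<otimes> y \<in> H" shows "u (inv x) y = \<one>\<^bsub>A'\<^esub>"
proof -
  have "y = inv x \<otimes> (x \<otimes> y)" using assms by (simp add: m_assoc[symmetric])
  then have "u (inv x) y = u (inv x) (inv x)" using u_H(2)[of "inv x" "inv x" "x \<otimes> y"] assms by simp
  then show ?thesis using assms by simp
qed

lemma u_inv_prod:
  assumes "x \<in> D" "y \<in> D" "x \<otimes> y \<notin> H"
  shows "u (inv (x \<otimes> y)) (inv y) = \<one>\<^bsub>A'\<^esub> \<ominus>\<^bsub>A'\<^esub> u (inv x) y"
proof -
  have n: "inv y \<otimes> inv x \<notin> H"
    using assms by (metis inv_mult_group inv_H_iff m_closed DiffD1)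
  have "u (inv y \<otimes> inv x) (inv y) \<oplus>\<^bsub>A'\<^esub> u (inv x) y = \<one>\<^bsub>A'\<^esub>"
    by (rule u_add) (use assms n in auto)
  moreover have "u (inv y \<otimes> inv x) (inv y) \<in> carrier A'" using assms n by simp
  moreover have "u (inv x) y \<in> carrier A'" using assms by simp
  ultimately have "u (inv y \<otimes> inv x) (inv y) = \<one>\<^bsub>A'\<^esub> \<ominus>\<^bsub>A'\<^esub> u (inv x) y"
    by (intro ring_add_eqD[OF AR.ring_axioms]) auto
  then show ?thesis using assms by (simp add: inv_mult_group)
qed

lemma fv_mult:
  assumes x: "x \<in> carrier G" and y: "y \<in> carrier G" shows "fv (x \<otimes> y) = fv y \<oplus>\<^bsub>A'\<^esub> fv x \<otimes>\<^bsub>A'\<^esub> fs y"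
proof (cases "x \<in> H")
  case True
  then show ?thesis using x y by (auto simp: fv_def inv_mult_group u_H)
next
  case xH: False
  show ?thesis
  proof (cases "y \<in> H")
    case True
    have "u (inv x) (y \<otimes> g) = u (inv y \<otimes> inv x) (inv y \<otimes> (y \<otimes> g))"
      using u_H(3)[of "inv x" "y \<otimes> g" "inv y"] x xH True by simp
    also have "inv y \<otimes> (y \<otimes> g) = g" using y by (simp add: m_assoc[symmetric])
    finally show ?thesis using xH True x y by (simp add: fv_def fs_def u_trans inv_mult_group)
  next
    case yH: False
    have [simp]: "x \<in> carrier G" "x \<notin> H" "y \<in> carrier G" "y \<notin> H" using x y xH yH by auto
    have "fv x \<otimes>\<^bsub>A'\<^esub> fs y = \<ominus>\<^bsub>A'\<^esub> (u (inv x) g \<otimes>\<^bsub>A'\<^esub> u g y \<otimes>\<^bsub>A'\<^esub> u (inv y) g)"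
      using x y xH yH by (simp add: fv_def fs_def AR.r_minus AR.m_assoc)
    also have "\<dots> = \<ominus>\<^bsub>A'\<^esub> (u (inv x) y \<otimes>\<^bsub>A'\<^esub> u (inv y) g)"
      using x y xH yH by (simp add: u_trans)
    finally have eq: "fv y \<oplus>\<^bsub>A'\<^esub> fv x \<otimes>\<^bsub>A'\<^esub> fs y = (\<one>\<^bsub>A'\<^esub> \<ominus>\<^bsub>A'\<^esub> u (inv x) y) \<otimes>\<^bsub>A'\<^esub> u (inv y) g"
      using x y xH yH by (simp add: fv_def AR.l_distr a_minus_def AR.l_minus)
    show ?thesis
    proof (cases "x \<otimes> y \<in> H")
      case True
      then show ?thesis unfolding eq using x y xH yH by (simp add: fv_def u_prod_H a_minus_def AR.r_neg)
    next
      case False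
      have "inv (x \<otimes> y) \<in> D" using False x y by simp
      then show ?thesis unfolding eq using False x y xH yH
        by (simp add: fv_def u_trans flip: u_inv_prod)
    qed
  qed
qed

lemma fs_mult:
  assumes x: "x \<in> carrier G" and y: "y \<in> carrier G" shows "fs x \<otimes>\<^bsub>A'\<^esub> fs y = fs (x \<otimes> y)"
proof (cases "x \<in> H")
  case xH: True
  show ?thesis
  proof (cases "y \<in> H")
    case True
    have "u g (y \<otimes> g) = u (x \<otimes> g) (x \<otimes> (y \<otimes> g))"
      using u_H(3)[of g "y \<otimes> g" x] xH True by simp
    then show ?thesis using xH True by (simp add: fs_def u_trans m_assoc)
  next
    case yH: False
    have "u g y = u (x \<otimes> g) (x \<otimes> y)" using u_H(3)[of g y x] y xH yH by simp
    then have "u g (x \<otimes> g) \<otimes>\<^bsub>A'\<^esub> u g y = u g (x \<otimes> y)"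
      using xH yH y by (simp add: u_trans)
    moreover have "u (inv (x \<otimes> y)) g = u (inv y) g"
      using xH yH y by (simp add: inv_mult_group u_H)
    ultimately show ?thesis using xH yH x y
      by (simp add: fs_def AR.r_minus AR.m_assoc[symmetric])
  qed
next
  case xH: False
  show ?thesis
  proof (cases "y \<in> H")
    case True
    have "u (inv x) (y \<otimes> g) = u (inv y \<otimes> inv x) (inv y \<otimes> (y \<otimes> g))"
      using u_H(3)[of "inv x" "y \<otimes> g" "inv y"] x xH True by simp
    also have "inv y \<otimes> (y \<otimes> g) = g" using y by (simp add: m_assoc[symmetric])
    finally have "u (inv x) g \<otimes>\<^bsub>A'\<^esub> u g (y \<otimes> g) = u (inv (x \<otimes> y)) g"
      using xH True x y by (simp add: u_trans inv_mult_group)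
    moreover have "u g (x \<otimes> y) = u g x" using True x xH by (simp add: u_H)
    ultimately show ?thesis using xH True x y
      by (simp add: fs_def AR.l_minus AR.m_assoc)
  next
    case yH: False
    have [simp]: "x \<in> carrier G" "x \<notin> H" "y \<in> carrier G" "y \<notin> H" using x y xH yH by auto
    let ?a = "u (inv x) y"
    have a: "?a \<in> carrier A'" using x xH y yH by simp
    have "fs x \<otimes>\<^bsub>A'\<^esub> fs y = u g x \<otimes>\<^bsub>A'\<^esub> ((u (inv x) g \<otimes>\<^bsub>A'\<^esub> u g y) \<otimes>\<^bsub>A'\<^esub> u (inv y) g)"
      using x y xH yH by (simp add: fs_def AR.l_minus AR.r_minus AR.m_assoc)
    also have "u (inv x) g \<otimes>\<^bsub>A'\<^esub> u g y = ?a" by (rule u_trans) (use x xH y yH g in auto)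
    finally have L: "fs x \<otimes>\<^bsub>A'\<^esub> fs y = u g x \<otimes>\<^bsub>A'\<^esub> (?a \<otimes>\<^bsub>A'\<^esub> u (inv y) g)" .
    show ?thesis
    proof (cases "x \<otimes> y \<in> H")
      case True
      have "u (inv y) g = u ((x \<otimes> y) \<otimes> inv y) ((x \<otimes> y) \<otimes> g)"
        using u_H(3)[of "inv y" g "x \<otimes> y"] True g y yH by simp
      also have "(x \<otimes> y) \<otimes> inv y = x" using x y by (simp add: m_assoc)
      finally show ?thesis unfolding L using True x y xH yH by (simp add: u_prod_H fs_def u_trans)
    next
      case False
      then have xyD: "x \<otimes> y \<in> D" "inv (x \<otimes> y) \<in> D" using x y by auto
      let ?b = "u (x \<otimes> y) x"
      have b: "?b \<in> carrier A'" using xyD x xH by simp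
      have "u (inv (inv x) \<otimes> y) (inv (inv x)) \<oplus>\<^bsub>A'\<^esub> u y (inv x) = \<one>\<^bsub>A'\<^esub>"
        by (rule u_add) (use x xH y yH False in auto)
      then have b1: "?b \<oplus>\<^bsub>A'\<^esub> u y (inv x) = \<one>\<^bsub>A'\<^esub>" using x by simp
      have yx: "u y (inv x) \<in> carrier A'" "u y (inv x) \<otimes>\<^bsub>A'\<^esub> ?a = \<one>\<^bsub>A'\<^esub>"
        using x xH y yH by (simp_all add: u_trans)
      have "(?b \<oplus>\<^bsub>A'\<^esub> u y (inv x)) \<otimes>\<^bsub>A'\<^esub> ?a = ?a" using b1 a by simp
      then have ba: "?b \<otimes>\<^bsub>A'\<^esub> ?a \<oplus>\<^bsub>A'\<^esub> \<one>\<^bsub>A'\<^esub> = ?a" using a b yx by (simp add: AR.l_distr)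
      have "?b \<otimes>\<^bsub>A'\<^esub> ?a = ?a \<ominus>\<^bsub>A'\<^esub> \<one>\<^bsub>A'\<^esub>"
        by (rule ring_add_eqD[OF AR.ring_axioms _ _ _ ba]) (use a b in auto)
      also have "\<dots> = \<ominus>\<^bsub>A'\<^esub> (\<one>\<^bsub>A'\<^esub> \<ominus>\<^bsub>A'\<^esub> ?a)"
        using a by (simp add: a_minus_def AR.minus_add AR.a_comm)
      also have "\<one>\<^bsub>A'\<^esub> \<ominus>\<^bsub>A'\<^esub> ?a = u (inv (x \<otimes> y)) (inv y)"
        by (rule u_inv_prod[symmetric]) (use x xH y yH False in auto)
      finally have ba': "?b \<otimes>\<^bsub>A'\<^esub> ?a = \<ominus>\<^bsub>A'\<^esub> u (inv (x \<otimes> y)) (inv y)" .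
      have "fs x \<otimes>\<^bsub>A'\<^esub> fs y = (u g (x \<otimes> y) \<otimes>\<^bsub>A'\<^esub> ?b) \<otimes>\<^bsub>A'\<^esub> (?a \<otimes>\<^bsub>A'\<^esub> u (inv y) g)"
        unfolding L using u_trans[of g "x \<otimes> y" x] xyD g by simp
      also have "\<dots> = u g (x \<otimes> y) \<otimes>\<^bsub>A'\<^esub> ((?b \<otimes>\<^bsub>A'\<^esub> ?a) \<otimes>\<^bsub>A'\<^esub> u (inv y) g)"
        using xyD a b g by (simp add: AR.m_assoc)
      also have "(?b \<otimes>\<^bsub>A'\<^esub> ?a) \<otimes>\<^bsub>A'\<^esub> u (inv y) g = \<ominus>\<^bsub>A'\<^esub> u (inv (x \<otimes> y)) g"
        unfolding ba' using u_trans[of "inv (x \<otimes> y)" "inv y" g] xyD g by (simp add: AR.l_minus)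
      also have "u g (x \<otimes> y) \<otimes>\<^bsub>A'\<^esub> (\<ominus>\<^bsub>A'\<^esub> u (inv (x \<otimes> y)) g) = fs (x \<otimes> y)"
        using False xyD g by (simp add: fs_def AR.r_minus)
      finally show ?thesis .
    qed
  qed
qed

lemma is_f_exists: "\<exists>f. is_f G H g f"
proof -
  define \<phi> where "\<phi> z = (case z of
      Sgen x \<Rightarrow> if x \<in> carrier G then fs x else \<zero>\<^bsub>A'\<^esub>
    | Vgen x \<Rightarrow> if x \<in> carrier G then fv x else \<zero>\<^bsub>A'\<^esub>
    | Vinv x \<Rightarrow> if x \<in> D then u g (inv x) else \<zero>\<^bsub>A'\<^esub>)" for z
  have val: "\<phi> z \<in> carrier A'" for z by (simp add: \<phi>_def split: sv_gen.split)
  interpret e: evaluation A' \<phi> using val AR.ring_axioms by (simp add: evaluation_def evaluation_axioms_def)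
  have fvi: "fv x \<otimes>\<^bsub>A'\<^esub> u g (inv x) = \<one>\<^bsub>A'\<^esub>" "u g (inv x) \<otimes>\<^bsub>A'\<^esub> fv x = \<one>\<^bsub>A'\<^esub>" if "x \<in> D" for x
    using that g by (simp_all add: fv_def u_trans)
  have fv0: "fv x = \<zero>\<^bsub>A'\<^esub>" if "x \<in> H" for x using that by (simp add: fv_def)
  have fs1: "fs \<one> = \<one>\<^bsub>A'\<^esub>" using g by (simp add: fs_def)
  have "free_eval A' \<phi> e = \<zero>\<^bsub>A'\<^esub>" if "e \<in> R_rels G H" for e
    using that g unfolding R_rels_def Un_iff mem_Collect_eq singleton_iff
    by (elim disjE exE conjE)
      (simp_all add: e.ev_diff e.ev_mult e.ev_add \<phi>_def fs1 fs_mult fv_mult fvi fv0 ring_minus_self[OF AR.ring_axioms])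
  from B.hom_exists[OF AR.ring_axioms val this] obtain f where
    f: "f \<in> ring_hom (presented_ring (R_gens G H) (R_rels G H)) A'"
    "f \<in> extensional (carrier (presented_ring (R_gens G H) (R_rels G H)))"
    "\<And>x. x \<in> R_gens G H \<Longrightarrow> f (B.c (gen x)) = \<phi> x" by blast
  have "u g (x \<otimes> g) = u (inv x \<otimes> g) g" if x: "x \<in> H" for x
  proof -
    have "u g (x \<otimes> g) = u (inv x \<otimes> g) (inv x \<otimes> (x \<otimes> g))"
      using u_H(3)[of g "x \<otimes> g" "inv x"] x by simp
    also have "inv x \<otimes> (x \<otimes> g) = g" using x by (simp add: m_assoc[symmetric])
    finally show ?thesis .
  qed
  then have "is_f G H g f"
    using f unfolding is_f_def R_ring_def[symmetric] s_elt_def v_elt_def by (simp add: \<phi>_def fs_def fv_def)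
  then show ?thesis by (rule exI[of _ f])
qed

end

declare gD [simp del]

subsection \<open>The homomorphism \<open>r\<close>\<close>

lemma is_r_exists:
  assumes t: "t \<in> Units R" shows "\<exists>r. is_r G H t r"
proof -
  define rs where "rs x = t \<otimes>\<^bsub>R\<^esub> s x \<otimes>\<^bsub>R\<^esub> inv\<^bsub>R\<^esub> t" for x
  define rv where "rv x = v x \<otimes>\<^bsub>R\<^esub> inv\<^bsub>R\<^esub> t" for x
  define ri where "ri x = t \<otimes>\<^bsub>R\<^esub> inv\<^bsub>R\<^esub> v x" for x
  define \<phi> where "\<phi> z = (case z of
      Sgen x \<Rightarrow> if x \<in> carrier G then rs x else \<zero>\<^bsub>R\<^esub>
    | Vgen x \<Rightarrow> if x \<in> carrier G then rv x else \<zero>\<^bsub>R\<^esub>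
    | Vinv x \<Rightarrow> if x \<in> D then ri x else \<zero>\<^bsub>R\<^esub>)" for z
  have t': "t \<in> carrier R" "inv\<^bsub>R\<^esub> t \<in> carrier R" using t by auto
  have vi: "inv\<^bsub>R\<^esub> v x \<in> carrier R" if "x \<in> D" for x using v_inv(1)[OF that] by (rule RR.Units_inv_closed)
  have rs: "rs x \<in> carrier R" and rv: "rv x \<in> carrier R" if "x \<in> carrier G" for x
    unfolding rs_def rv_def by (intro RR.m_closed t' sv_closed that)+
  have ri: "ri x \<in> carrier R" if "x \<in> D" for x
    unfolding ri_def by (intro RR.m_closed t' vi that)
  have val: "\<phi> z \<in> carrier R" for z
    using rs rv ri by (simp add: \<phi>_def split: sv_gen.split)
  interpret e: evaluation R \<phi> using val RR.ring_axioms by (simp add: evaluation_def evaluation_axioms_def)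
  have cancel: "a \<otimes>\<^bsub>R\<^esub> inv\<^bsub>R\<^esub> t \<otimes>\<^bsub>R\<^esub> (t \<otimes>\<^bsub>R\<^esub> b) = a \<otimes>\<^bsub>R\<^esub> b" if "a \<in> carrier R" "b \<in> carrier R" for a b
  proof -
    have "a \<otimes>\<^bsub>R\<^esub> inv\<^bsub>R\<^esub> t \<otimes>\<^bsub>R\<^esub> (t \<otimes>\<^bsub>R\<^esub> b) = a \<otimes>\<^bsub>R\<^esub> ((inv\<^bsub>R\<^esub> t \<otimes>\<^bsub>R\<^esub> t) \<otimes>\<^bsub>R\<^esub> b)"
      using that t' by (simp add: RR.m_assoc del: RR.Units_l_inv)
    then show ?thesis using that t by simp
  qed
  have S: "(t \<otimes>\<^bsub>R\<^esub> s x \<otimes>\<^bsub>R\<^esub> inv\<^bsub>R\<^esub> t) \<otimes>\<^bsub>R\<^esub> (t \<otimes>\<^bsub>R\<^esub> s y \<otimes>\<^bsub>R\<^esub> inv\<^bsub>R\<^esub> t) = t \<otimes>\<^bsub>R\<^esub> s (x \<otimes> y) \<otimes>\<^bsub>R\<^esub> inv\<^bsub>R\<^esub> t"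
    if xy: "x \<in> carrier G" "y \<in> carrier G" for x y
  proof -
    note c = sv_closed(1)[OF xy(1)] sv_closed(1)[OF xy(2)]
    have "(t \<otimes>\<^bsub>R\<^esub> s x \<otimes>\<^bsub>R\<^esub> inv\<^bsub>R\<^esub> t) \<otimes>\<^bsub>R\<^esub> (t \<otimes>\<^bsub>R\<^esub> s y \<otimes>\<^bsub>R\<^esub> inv\<^bsub>R\<^esub> t) = (t \<otimes>\<^bsub>R\<^esub> s x) \<otimes>\<^bsub>R\<^esub> inv\<^bsub>R\<^esub> t \<otimes>\<^bsub>R\<^esub> (t \<otimes>\<^bsub>R\<^esub> (s y \<otimes>\<^bsub>R\<^esub> inv\<^bsub>R\<^esub> t))"
      using c t' by (simp only: RR.m_assoc RR.m_closed)
    also have "\<dots> = (t \<otimes>\<^bsub>R\<^esub> s x) \<otimes>\<^bsub>R\<^esub> (s y \<otimes>\<^bsub>R\<^esub> inv\<^bsub>R\<^esub> t)"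
      by (rule cancel) (use c t' in \<open>simp_all only: RR.m_closed\<close>)
    also have "\<dots> = t \<otimes>\<^bsub>R\<^esub> (s x \<otimes>\<^bsub>R\<^esub> s y) \<otimes>\<^bsub>R\<^esub> inv\<^bsub>R\<^esub> t"
      using c t' by (simp only: RR.m_assoc RR.m_closed)
    finally show ?thesis unfolding s_mult[OF xy] .
  qed
  have VS: "v (x \<otimes> y) \<otimes>\<^bsub>R\<^esub> inv\<^bsub>R\<^esub> t = v y \<otimes>\<^bsub>R\<^esub> inv\<^bsub>R\<^esub> t \<oplus>\<^bsub>R\<^esub> (v x \<otimes>\<^bsub>R\<^esub> inv\<^bsub>R\<^esub> t) \<otimes>\<^bsub>R\<^esub> (t \<otimes>\<^bsub>R\<^esub> s y \<otimes>\<^bsub>R\<^esub> inv\<^bsub>R\<^esub> t)"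
    if xy: "x \<in> carrier G" "y \<in> carrier G" for x y
  proof -
    note c = sv_closed(1)[OF xy(2)] sv_closed(2)[OF xy(1)] sv_closed(2)[OF xy(2)]
    have "(v x \<otimes>\<^bsub>R\<^esub> inv\<^bsub>R\<^esub> t) \<otimes>\<^bsub>R\<^esub> (t \<otimes>\<^bsub>R\<^esub> s y \<otimes>\<^bsub>R\<^esub> inv\<^bsub>R\<^esub> t) = (v x \<otimes>\<^bsub>R\<^esub> inv\<^bsub>R\<^esub> t) \<otimes>\<^bsub>R\<^esub> (t \<otimes>\<^bsub>R\<^esub> (s y \<otimes>\<^bsub>R\<^esub> inv\<^bsub>R\<^esub> t))"
      using c t' by (simp only: RR.m_assoc RR.m_closed)
    also have "\<dots> = v x \<otimes>\<^bsub>R\<^esub> (s y \<otimes>\<^bsub>R\<^esub> inv\<^bsub>R\<^esub> t)"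
      by (rule cancel) (use c t' in \<open>simp_all only: RR.m_closed\<close>)
    also have "\<dots> = (v x \<otimes>\<^bsub>R\<^esub> s y) \<otimes>\<^bsub>R\<^esub> inv\<^bsub>R\<^esub> t"
      using c t' by (simp only: RR.m_assoc)
    finally show ?thesis
      unfolding v_mult[OF xy] using c t' by (simp only: RR.l_distr RR.m_closed)
  qed
  have V1: "(v x \<otimes>\<^bsub>R\<^esub> inv\<^bsub>R\<^esub> t) \<otimes>\<^bsub>R\<^esub> (t \<otimes>\<^bsub>R\<^esub> inv\<^bsub>R\<^esub> v x) = \<one>\<^bsub>R\<^esub>" if "x \<in> D" for x

    unfolding cancel[OF sv_closed(2)[OF DiffD1[OF that]] vi[OF that]] by (rule RR.Units_r_inv[OF v_inv(1)[OF that]])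
  have V2: "(t \<otimes>\<^bsub>R\<^esub> inv\<^bsub>R\<^esub> v x) \<otimes>\<^bsub>R\<^esub> (v x \<otimes>\<^bsub>R\<^esub> inv\<^bsub>R\<^esub> t) = \<one>\<^bsub>R\<^esub>" if x: "x \<in> D" for x
  proof -
    have "(t \<otimes>\<^bsub>R\<^esub> inv\<^bsub>R\<^esub> v x) \<otimes>\<^bsub>R\<^esub> (v x \<otimes>\<^bsub>R\<^esub> inv\<^bsub>R\<^esub> t) = t \<otimes>\<^bsub>R\<^esub> ((inv\<^bsub>R\<^esub> v x \<otimes>\<^bsub>R\<^esub> v x) \<otimes>\<^bsub>R\<^esub> inv\<^bsub>R\<^esub> t)"
      using t' vi[OF x] sv_closed(2)[OF DiffD1[OF x]] by (simp only: RR.m_assoc RR.m_closed)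
    also have "\<dots> = \<one>\<^bsub>R\<^esub>"
      unfolding RR.Units_l_inv[OF v_inv(1)[OF x]] RR.l_one[OF t'(2)] by (rule RR.Units_r_inv[OF t])
    finally show ?thesis .
  qed
  have rels: "rs x \<otimes>\<^bsub>R\<^esub> rs y = rs (x \<otimes> y)" "rv (x \<otimes> y) = rv y \<oplus>\<^bsub>R\<^esub> rv x \<otimes>\<^bsub>R\<^esub> rs y"
    if "x \<in> carrier G" "y \<in> carrier G" for x y
    unfolding rs_def rv_def by (fact S[OF that], fact VS[OF that])
  have rinv: "rv x \<otimes>\<^bsub>R\<^esub> ri x = \<one>\<^bsub>R\<^esub>" "ri x \<otimes>\<^bsub>R\<^esub> rv x = \<one>\<^bsub>R\<^esub>" if "x \<in> D" for x
    unfolding ri_def rv_def by (fact V1[OF that], fact V2[OF that])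
  have rv0: "rv x = \<zero>\<^bsub>R\<^esub>" if "x \<in> H" for x
    using t' that by (simp add: rv_def)
  have rs1: "rs \<one> = \<one>\<^bsub>R\<^esub>"
    unfolding rs_def s_one RR.r_one[OF t'(1)] by (rule RR.Units_r_inv[OF t])
  have "free_eval R \<phi> e = \<zero>\<^bsub>R\<^esub>" if "e \<in> R_rels G H" for e
    using that unfolding R_rels_def Un_iff mem_Collect_eq singleton_iff
    by (elim disjE exE conjE) (simp_all add: e.ev_diff e.ev_mult e.ev_add \<phi>_def rels rinv rv0 rs1 rs rv ring_minus_self[OF RR.ring_axioms])
  from B.hom_exists[OF RR.ring_axioms val this] obtain r where
    "r \<in> ring_hom (presented_ring (R_gens G H) (R_rels G H)) R"
    "r \<in> extensional (carrier (presented_ring (R_gens G H) (R_rels G H)))"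
    "\<And>x. x \<in> R_gens G H \<Longrightarrow> r (B.c (gen x)) = \<phi> x" by blast
  then have "is_r G H t r"
    unfolding is_r_def s_elt_def v_elt_def by (simp add: \<phi>_def rs_def rv_def s_elt_def v_elt_def flip: R_ring_def)
  then show ?thesis by (rule exI[of _ r])
qed

lemma is_q_unique: "is_q G H q \<Longrightarrow> is_q G H q' \<Longrightarrow> q = q'"
  by (rule AG_hom_unique[OF RR.ring_axioms]) (auto simp: is_q_def)

lemma is_f_unique:
  assumes "is_f G H g f" "is_f G H g f'" shows "f = f'"
proof (rule R_hom_unique[OF AR.ring_axioms])
  fix x assume "x \<in> carrier G"
  then show "f (s x) = f' (s x)" "f (v x) = f' (v x)"
    using assms unfolding is_f_def by (metis DiffI)+
qed (use assms[unfolded is_f_def] in blast)+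

lemma is_r_unique: "is_r G H t r \<Longrightarrow> is_r G H t r' \<Longrightarrow> r = r'"
  by (rule R_hom_unique[OF RR.ring_axioms]) (auto simp: is_r_def)

end

theorem is_q_q_hom:
  assumes "group G" "subgroup H G"
  shows "is_q G H (q_hom G H)"
proof -
  interpret group_pair G H using assms by (simp add: group_pair_def group_pair_axioms_def)
  show ?thesis
    unfolding q_hom_def by (rule theI'[of "is_q G H"]) (rule ex_ex1I[OF is_q_exists is_q_unique])
qed

theorem is_f_f_hom:
  assumes "group G" "subgroup H G" "g \<in> carrier G - H"
  shows "is_f G H g (f_hom G H g)"
proof -
  interpret group_pair G H using assms by (simp add: group_pair_def group_pair_axioms_def)
  show ?thesis
    unfolding f_hom_def by (rule theI'[of "is_f G H g"]) (rule ex_ex1I[OF is_f_exists[OF assms(3)] is_f_unique])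
qed

theorem is_r_r_hom:
  assumes "group G" "subgroup H G" "t \<in> Units (R_ring G H)"
  shows "is_r G H t (r_hom G H t)"
proof -
  interpret group_pair G H using assms by (simp add: group_pair_def group_pair_axioms_def)
  show ?thesis
    unfolding r_hom_def by (rule theI'[of "is_r G H t"]) (rule ex_ex1I[OF is_r_exists[OF assms(3)] is_r_unique])
qed

end

theory Submission
  imports Defs
begin

text \<open>Homomorphisms out of the two rings are determined by their values on the
  \<open>u x y\<close>, respectively on the \<open>s x\<close> and \<open>v x\<close>, because they
  preserve inverses. So both identities are checked on these elements; write t for
  \<open>v (inv g)\<close>. For f q, the element \<open>u x y\<close> goes to u_{x,g} u_{y,g}^{-1} =
  u_{x,g} u_{g,y} = u_{x,y}: the base point g telescopes away. For q f, the value at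
  \<open>v x\<close> is read off the definitions. At \<open>s x\<close> with x in H,
  v_{g^{-1}x^{-1}} = t s_{x^{-1}} turns the image of u_{g,xg} into t s_x t^{-1}. For x outside H the
  image is -t v_{x^{-1}}^{-1} v_x t^{-1}, and \<open>inv_v_inv_mult_v\<close> replaces the middle
  product by -s_x.\<close>

context group_pair
begin

lemma f_hom_q_hom:
  assumes g: "g \<in> D"
  shows "compose (carrier A') (f_hom G H g) (q_hom G H) = (\<lambda>a \<in> carrier A'. a)"
proof (rule AG_hom_unique[OF AR.ring_axioms])
  let ?f = "f_hom G H g" and ?q = "q_hom G H"
  have f: "is_f G H g ?f" by (rule is_f_f_hom[OF group_axioms sub g])
  have q: "is_q G H ?q" by (rule is_q_q_hom[OF group_axioms sub])
  have fh: "?f \<in> ring_hom R A'" and qh: "?q \<in> ring_hom A' R"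
    using f q by (auto simp: is_f_def is_q_def)
  have qc: "a \<in> carrier A' \<Longrightarrow> ?q a \<in> carrier R" for a by (rule ring_hom_closed[OF qh])
  show "compose (carrier A') ?f ?q \<in> ring_hom A' A'"
    by (rule ring_hom_memI)
      (simp_all add: compose_def qc ring_hom_closed[OF fh] ring_hom_mult[OF qh] ring_hom_mult[OF fh]
        ring_hom_add[OF qh] ring_hom_add[OF fh] ring_hom_one[OF qh] ring_hom_one[OF fh])
  show "(\<lambda>a \<in> carrier A'. a) \<in> ring_hom A' A'"
    by (rule ring_hom_memI) simp_all
  show "compose (carrier A') ?f ?q (u x y) = (\<lambda>a \<in> carrier A'. a) (u x y)" if x: "x \<in> D" and y: "y \<in> D" for x y
  proof -
    have fv: "?f (v (inv z)) = u z g" if "z \<in> D" for z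
      using f that by (simp add: is_f_def)
    have U: "v (inv x) \<in> Units R" "v (inv y) \<in> Units R" using x y by (auto intro: v_inv(1))
    have "?f (?q (u x y)) = ?f (v (inv x) \<otimes>\<^bsub>R\<^esub> inv\<^bsub>R\<^esub> v (inv y))"
      using q x y by (simp add: is_q_def)
    also have "\<dots> = u x g \<otimes>\<^bsub>A'\<^esub> inv\<^bsub>A'\<^esub> u y g"
      using U x y by (simp add: ring_hom_mult[OF fh] RR.Units_closed fv
          hom_inv[OF RR.ring_axioms AR.ring_axioms fh])
    \<comment> \<open>The inverse of \<open>u y g\<close> is \<open>u g y\<close>, so the product
      telescopes through g.\<close>
    also have "\<dots> = u x y"
      using x y g by (simp add: u_inv_eq u_trans)
    finally show ?thesis using x y by (simp add: compose_def)
  qed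
qed (simp_all add: compose_def)

text \<open>Expanding v_1 = 0 along 1 = x^{-1} x gives v_x + v_{x^{-1}} s_x = 0; dividing on the
  left by v_{x^{-1}} isolates s_x. This explains the sign in the value of f_g at s_x for x outside
  H.\<close>

lemma inv_v_inv_mult_v:
  assumes x: "x \<in> D" shows "inv\<^bsub>R\<^esub> v (inv x) \<otimes>\<^bsub>R\<^esub> v x = \<ominus>\<^bsub>R\<^esub> s x"
proof -
  have U: "v (inv x) \<in> Units R" using x by (auto intro: v_inv(1))
  have c: "v (inv x) \<in> carrier R" "inv\<^bsub>R\<^esub> v (inv x) \<in> carrier R" "v x \<in> carrier R" "s x \<in> carrier R"
    using U x by auto
  have "v x = \<ominus>\<^bsub>R\<^esub> (v (inv x) \<otimes>\<^bsub>R\<^esub> s x)"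
    using v_inv_left[of x] x c by (intro RR.minus_equality[symmetric]) auto
  then have "inv\<^bsub>R\<^esub> v (inv x) \<otimes>\<^bsub>R\<^esub> v x = \<ominus>\<^bsub>R\<^esub> ((inv\<^bsub>R\<^esub> v (inv x) \<otimes>\<^bsub>R\<^esub> v (inv x)) \<otimes>\<^bsub>R\<^esub> s x)"
    using c by (simp add: RR.r_minus RR.m_assoc del: RR.Units_l_inv)
  then show ?thesis using U c by simp
qed

text \<open>The composite is shown to satisfy the description \<open>is_r\<close> for t =
  \<open>v (inv g)\<close>, which has only one solution.\<close>

lemma q_hom_f_hom:
  assumes g: "g \<in> D"
  shows "compose (carrier R) (q_hom G H) (f_hom G H g) = r_hom G H (v (inv g))"
proof -
  let ?f = "f_hom G H g" and ?q = "q_hom G H" and ?t = "v (inv g)"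
  have t: "?t \<in> Units R" using g by (auto intro: v_inv(1))
  have f: "is_f G H g ?f" by (rule is_f_f_hom[OF group_axioms sub g])
  have q: "is_q G H ?q" by (rule is_q_q_hom[OF group_axioms sub])
  have r: "is_r G H ?t (r_hom G H ?t)" by (rule is_r_r_hom[OF group_axioms sub t])
  have fh: "?f \<in> ring_hom R A'" and qh: "?q \<in> ring_hom A' R"
    using f q by (auto simp: is_f_def is_q_def)
  \<comment> \<open>Provides that q preserves negatives and zero, needed for the values of f at
    \<open>s x\<close> outside H and at \<open>v x\<close> inside H.\<close>
  interpret q: ring_hom_ring A' R ?q
    by (intro ring_hom_ringI2 AR.ring_axioms RR.ring_axioms qh)
  have fc: "a \<in> carrier R \<Longrightarrow> ?f a \<in> carrier A'" for a by (rule ring_hom_closed[OF fh])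
  have tc: "?t \<in> carrier R" "inv\<^bsub>R\<^esub> ?t \<in> carrier R" using t by auto
  have qu: "?q (u x y) = v (inv x) \<otimes>\<^bsub>R\<^esub> inv\<^bsub>R\<^esub> v (inv y)" if "x \<in> D" "y \<in> D" for x y
    using q that by (simp add: is_q_def)
  have hom: "compose (carrier R) ?q ?f \<in> ring_hom R R"
    by (rule ring_hom_memI)
      (simp_all add: compose_def fc ring_hom_mult[OF fh] ring_hom_add[OF fh] ring_hom_one[OF fh])
  have qfs: "?q (?f (s x)) = ?t \<otimes>\<^bsub>R\<^esub> s x \<otimes>\<^bsub>R\<^esub> inv\<^bsub>R\<^esub> ?t" if x: "x \<in> carrier G" for x
  proof (cases "x \<in> H")
    case True
    have "?q (?f (s x)) = ?q (u g (x \<otimes> g))" using f True by (simp add: is_f_def)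
    \<comment> \<open>In v_{g^{-1}x^{-1}} = v_{x^{-1}} + v_{g^{-1}} s_{x^{-1}} the first summand
      vanishes, as x^{-1} lies in H.\<close>
    also have "\<dots> = ?t \<otimes>\<^bsub>R\<^esub> inv\<^bsub>R\<^esub> (?t \<otimes>\<^bsub>R\<^esub> s (inv x))"
      using True g by (simp add: qu inv_mult_group v_Hmult)
    also have "\<dots> = ?t \<otimes>\<^bsub>R\<^esub> (s x \<otimes>\<^bsub>R\<^esub> inv\<^bsub>R\<^esub> ?t)"
      using t x by (simp add: inv_mult_units[OF RR.ring_axioms] s_unit)
    finally show ?thesis using tc x by (simp add: RR.m_assoc)
  next
    case False
    then have xD: "x \<in> D" "inv x \<in> D" using x by auto
    have c: "inv\<^bsub>R\<^esub> v (inv x) \<in> carrier R" "v x \<in> carrier R" "s x \<in> carrier R"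
      using v_inv(1)[OF xD(2)] x by auto
    have "?q (?f (s x)) = ?q (\<ominus>\<^bsub>A'\<^esub> (u g x \<otimes>\<^bsub>A'\<^esub> u (inv x) g))"
      using f xD by (simp add: is_f_def)
    also have "\<dots> = \<ominus>\<^bsub>R\<^esub> ((?t \<otimes>\<^bsub>R\<^esub> inv\<^bsub>R\<^esub> v (inv x)) \<otimes>\<^bsub>R\<^esub> (v x \<otimes>\<^bsub>R\<^esub> inv\<^bsub>R\<^esub> ?t))"
      using xD g by (simp add: qu)
    \<comment> \<open>The regrouping exposes the middle product, equal to -s_x; the two signs then
      cancel.\<close>
    also have "\<dots> = \<ominus>\<^bsub>R\<^esub> (?t \<otimes>\<^bsub>R\<^esub> ((inv\<^bsub>R\<^esub> v (inv x) \<otimes>\<^bsub>R\<^esub> v x) \<otimes>\<^bsub>R\<^esub> inv\<^bsub>R\<^esub> ?t))"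
      using c tc by (simp add: RR.m_assoc)
    also have "\<dots> = ?t \<otimes>\<^bsub>R\<^esub> s x \<otimes>\<^bsub>R\<^esub> inv\<^bsub>R\<^esub> ?t"
      using c tc by (simp add: inv_v_inv_mult_v[OF xD(1)] RR.l_minus RR.r_minus RR.m_assoc)
    finally show ?thesis .
  qed
  have qfv: "?q (?f (v x)) = v x \<otimes>\<^bsub>R\<^esub> inv\<^bsub>R\<^esub> ?t" if x: "x \<in> carrier G" for x
  proof (cases "x \<in> H")
    case True
    then have "?f (v x) = \<zero>\<^bsub>A'\<^esub>" using f unfolding is_f_def by blast
    then show ?thesis using True tc by simp
  next
    case False
    then have "?f (v x) = u (inv x) g" using f x by (simp add: is_f_def)
    then show ?thesis using False x g by (simp add: qu)
  qed
  have "is_r G H ?t (compose (carrier R) ?q ?f)"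
    unfolding is_r_def using hom by (simp add: compose_def qfs qfv)
  then show ?thesis using r by (rule is_r_unique)
qed

end

theorem proposition5:
  fixes G :: "('g, 'm) monoid_scheme" and H :: "'g set" and g :: 'g
  assumes "group G"
    and "malnormal H G"
    and "H \<noteq> carrier G"
    and "g \<in> carrier G - H"
  shows "compose (carrier (AG_ring G H)) (f_hom G H g) (q_hom G H) = (\<lambda>a \<in> carrier (AG_ring G H). a)
    \<and> compose (carrier (R_ring G H)) (q_hom G H) (f_hom G H g) = r_hom G H (v_elt G H (inv\<^bsub>G\<^esub> g))"
proof -
  interpret group_pair G H
    using assms(1,2) by (simp add: group_pair_def group_pair_axioms_def malnormal_def)
  show ?thesis
    using f_hom_q_hom[OF assms(4)] q_hom_f_hom[OF assms(4)] by simp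
qed

end
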